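(* Let $M=(M_t)_{t\in\mathbb R_+}$ be an adapted right-continuous process. In order that $M$ be a local martingale with respect to $\mathbb F$ it is necessary and sufficient that there be a pair $(F,H)$ satisfying Condition M and a random variable $L'$ satisfying $$\mathsf E\bigl(|L'|\mathbf 1_{\{\gamma\leqslant t\}}\bigr)<\infty\quad (t\in\mathcal T)\qquad\text{and}\qquad \mathsf E[L'|\gamma]=0,$$ such that, up to $\mathsf P$-indistinguishability, $$M_t=F(t)\mathbf 1_{\{t<\gamma\}}+\bigl(H(\gamma)+L'\bigr)\mathbf 1_{\{t\geqslant\gamma\}},\qquad t\in\mathbb R_+.$$
   Context: Setting. $(\Omega,\mathscr F,\mathsf P)$ is a probability space, $\gamma$ is a random variable with values in $[0,+\infty]$ with $\mathsf P(\gamma>0)>0$, $\mathbb R_+=[0,\infty)$, $G(t)=\mathsf P(\gamma\leqslant t)$ for $t\in\mathbb R_+$, $\overline G=1-G$, $t_G=\sup\{t\in\mathbb R_+: G(t)<1\}$, $\mathcal T=\{t\in\mathbb R_+:\mathsf P(\gamma\geqslant t)>0\}$. Case A: $\mathsf P(\gamma=t_G<\infty)=0$ (then $\mathcal T=[0,t_G)$). Case B: $\mathsf P(\gamma=t_G<\infty)>0$ (then $\mathcal T=[0,t_G]$). Single jump filtration: $\mathbb F=(\mathscr F_t)_{t\in\mathbb R_+}$, where $\mathscr F_t$ is the collection of all $A\in\mathscr F$ such that $A\cap\{t<\gamma\}$ is either $\varnothing$ or equal to $\{t<\gamma\}$; it is increasing and right-continuous, not assumed complete. $L^1_{\mathrm{loc}}(dG)$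 is the set of Borel functions $z:\mathcal T\to\mathbb R$ with $\int_{[0,t]}|z(s)|\,dG(s)<\infty$ for all $t\in\mathcal T$ (the measure $dG$ has mass $G(0)$ at $0$). For $Z:[0,t_G)\to\mathbb R$ write $Z\overset{\mathrm{loc}}{\ll}G$ if there is $z\in L^1_{\mathrm{loc}}(dG)$ with $Z(t)=Z(0)+\int_{(0,t]}z(s)\,dG(s)$ for all $t<t_G$. A pair $(F,H)$ satisfies Condition M if: $F:[0,t_G)\to\mathbb R$ with $F\overset{\mathrm{loc}}{\ll}G$; $H:\mathcal T\to\mathbb R$ with $H\in L^1_{\mathrm{loc}}(dG)$; $$F(t)\overline G(t)+\int_{(0,t]}H(s)\,dG(s)=F(0)\overline G(0),\qquad t<t_G;$$ and, additionally in Case B, $\lim_{t\uparrow t_G,\,t<t_G}F(t)=H(t_G)$. Conventions. In the representation, $F$ is extended arbitrarily to a right-continuous function on $[t_G,\infty)$ if $t_G<\infty$, and $H$ is extended by $0$ outside $\mathcal T$ (the values outside $\mathcal T$ matter only on a null set). For a random variable $Y$ with $\mathsf E[|Y|\,|\gamma]<\infty$ a.s., $\mathsf E[Y|\gamma]:=\mathsf E[Y^+|\gamma]-\mathsf E[Y^-|\gamma]$ (generalized conditional expectation). Two processes are $\mathsf P$-indistinguishable if the set where they differ is contained in $N\times\mathbb R_+$ with $\mathsf P(N)=0$. An adapted process $M$ with almost all paths c\`adl\`ag is a local martingale if there are stopping times $T_n$ with $T_n\uparrow\infty$ a.s. such that each stopped process $M^{T_n}$ is a uniformly integrable martingale. 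*)

theory Defs
  imports "HOL-Probability.Probability" "HOL-Probability.Stopping_Time"
begin

section \<open>Stochastic processes on the half-line\<close>

text \<open>
  A process indexed by the half-line of nonnegative reals has type \<open>real \<Rightarrow> 'a \<Rightarrow> real\<close>; only its
  values at times \<open>t \<ge> 0\<close> are ever used. Filtrations are indexed by \<open>ennreal\<close>, so that the
  library's \<open>stopping_time\<close> covers stopping times with values in \<open>[0, \<infinity>]\<close>: its defining
  condition at the index \<open>\<infinity>\<close>, measurability of \<open>{T \<le> \<infinity>}\<close>, is void. Processes and martingales
  refer to the filtration at finite indices only.
\<close>

definition adapted_process :: "(ennreal \<Rightarrow> 'a measure) \<Rightarrow> (real \<Rightarrow> 'a \<Rightarrow> real) \<Rightarrow> bool" where
  "adapted_process F X \<longleftrightarrow> (\<forall>t\<ge>0. X t \<in> borel_measurable (F (ennreal t)))"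

definition right_continuous_path :: "(real \<Rightarrow> real) \<Rightarrow> bool" where
  "right_continuous_path x \<longleftrightarrow> (\<forall>t\<ge>0. continuous (at_right t) x)"

definition cadlag_path :: "(real \<Rightarrow> real) \<Rightarrow> bool" where
  "cadlag_path x \<longleftrightarrow> right_continuous_path x \<and> (\<forall>t>0. \<exists>l. (x \<longlongrightarrow> l) (at_left t))"

definition indistinguishable ::
    "'a measure \<Rightarrow> (real \<Rightarrow> 'a \<Rightarrow> real) \<Rightarrow> (real \<Rightarrow> 'a \<Rightarrow> real) \<Rightarrow> bool" where
  "indistinguishable P X Y \<longleftrightarrow> (AE \<omega> in P. \<forall>t\<ge>0. X t \<omega> = Y t \<omega>)"

definition stopped_process ::
    "(real \<Rightarrow> 'a \<Rightarrow> real) \<Rightarrow> ('a \<Rightarrow> ennreal) \<Rightarrow> real \<Rightarrow> 'a \<Rightarrow> real" where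
  "stopped_process X T t \<omega> = X (enn2real (min (ennreal t) (T \<omega>))) \<omega>"

definition martingale ::
    "'a measure \<Rightarrow> (ennreal \<Rightarrow> 'a measure) \<Rightarrow> (real \<Rightarrow> 'a \<Rightarrow> real) \<Rightarrow> bool" where
  "martingale P F X \<longleftrightarrow>
     adapted_process F X \<and>
     (\<forall>t\<ge>0. integrable P (X t)) \<and>
     (\<forall>s\<ge>0. \<forall>t\<ge>s. AE \<omega> in P. real_cond_exp P (F (ennreal s)) (X t) \<omega> = X s \<omega>)"

definition uniformly_integrable :: "'a measure \<Rightarrow> (real \<Rightarrow> 'a \<Rightarrow> real) \<Rightarrow> bool" where
  "uniformly_integrable P X \<longleftrightarrow>
     ((\<lambda>K::real. SUP t\<in>{0..}. \<integral>\<^sup>+\<omega>. ennreal \<bar>X t \<omega>\<bar> * indicator {\<omega>. \<bar>X t \<omega>\<bar> \<ge> K} \<omega> \<partial>P)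
        \<longlongrightarrow> 0) at_top"

definition local_martingale ::
    "'a measure \<Rightarrow> (ennreal \<Rightarrow> 'a measure) \<Rightarrow> (real \<Rightarrow> 'a \<Rightarrow> real) \<Rightarrow> bool" where
  "local_martingale P F X \<longleftrightarrow>
     adapted_process F X \<and>
     (AE \<omega> in P. cadlag_path (\<lambda>t. X t \<omega>)) \<and>
     (\<exists>T :: nat \<Rightarrow> 'a \<Rightarrow> ennreal.
        (\<forall>n. stopping_time F (T n)) \<and>
        (AE \<omega> in P. incseq (\<lambda>n. T n \<omega>) \<and> (\<lambda>n. T n \<omega>) \<longlonglongrightarrow> \<infinity>) \<and>
        (\<forall>n. martingale P F (stopped_process X (T n)) \<and>
             uniformly_integrable P (stopped_process X (T n))))"


section \<open>The single jump filtration\<close>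

text \<open>
  At the index \<open>\<infinity>\<close> this is the whole \<open>\<sigma>\<close>-algebra, because \<open>{\<infinity> < \<gamma>}\<close> is empty.
\<close>

definition single_jump_filtration ::
    "'a measure \<Rightarrow> ('a \<Rightarrow> ennreal) \<Rightarrow> ennreal \<Rightarrow> 'a measure" where
  "single_jump_filtration P \<gamma> t =
     sigma (space P)
       {A \<in> sets P. A \<inter> {\<omega> \<in> space P. t < \<gamma> \<omega>} = {} \<or>
                    A \<inter> {\<omega> \<in> space P. t < \<gamma> \<omega>} = {\<omega> \<in> space P. t < \<gamma> \<omega>}}"

lemma space_single_jump_filtration [simp]: "space (single_jump_filtration P \<gamma> t) = space P"
  by (auto simp: single_jump_filtration_def space_measure_of_conv)

text \<open>The generating collection is already a \<open>\<sigma>\<close>-algebra.\<close>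

lemma sets_single_jump_filtration:
  "sets (single_jump_filtration P \<gamma> t) =
     {A \<in> sets P. A \<inter> {\<omega> \<in> space P. t < \<gamma> \<omega>} = {} \<or>
                  A \<inter> {\<omega> \<in> space P. t < \<gamma> \<omega>} = {\<omega> \<in> space P. t < \<gamma> \<omega>}}"
  (is "_ = ?S")
proof -
  let ?B = "{\<omega> \<in> space P. t < \<gamma> \<omega>}"
  have "sigma_algebra (space P) ?S"
    unfolding sigma_algebra_iff2
  proof (intro conjI ballI allI impI)
    show "?S \<subseteq> Pow (space P)"
      using sets.space_closed by blast
    show "{} \<in> ?S" by simp
    show "space P - A \<in> ?S" if "A \<in> ?S" for A
      using that by auto
    show "(\<Union>i::nat. A i) \<in> ?S" if A: "range A \<subseteq> ?S" for A
    proof -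
      have *: "A i \<in> sets P" "A i \<inter> ?B = {} \<or> ?B \<subseteq> A i" for i
        using A by blast+
      have "(\<Union>i. A i) \<inter> ?B = {} \<or> ?B \<subseteq> (\<Union>i. A i)"
        using *(2) by blast
      then show ?thesis
        using *(1) by blast
    qed
  qed
  then show ?thesis
    unfolding single_jump_filtration_def
    by (subst sets_measure_of)
       (auto simp: sigma_algebra.sigma_sets_eq dest: sets.sets_into_space)
qed

lemma filtration_single_jump_filtration: "filtration (space P) (single_jump_filtration P \<gamma>)"
proof
  fix s t :: ennreal
  assume "s \<le> t"
  then have "{\<omega> \<in> space P. t < \<gamma> \<omega>} \<subseteq> {\<omega> \<in> space P. s < \<gamma> \<omega>}"
    by auto
  then show "sets (single_jump_filtration P \<gamma> s) \<subseteq> sets (single_jump_filtration P \<gamma> t)"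
    unfolding sets_single_jump_filtration by blast
qed simp

lemma subalgebra_single_jump_filtration: "subalgebra P (single_jump_filtration P \<gamma> t)"
  by (auto simp: subalgebra_def sets_single_jump_filtration)


section \<open>The distribution of the jump time\<close>

text \<open>
  The function \<open>G\<close> is continued by \<open>0\<close> to the negative axis, so that its Lebesgue--Stieltjes
  measure has mass \<open>G(0)\<close> at \<open>0\<close>. (The case distinction is needed since \<open>ennreal t = 0\<close> for
  \<open>t < 0\<close>.)
\<close>

definition jump_cdf :: "'a measure \<Rightarrow> ('a \<Rightarrow> ennreal) \<Rightarrow> real \<Rightarrow> real" where
  "jump_cdf P \<gamma> t = (if t < 0 then 0 else measure P {\<omega> \<in> space P. \<gamma> \<omega> \<le> ennreal t})"

definition jump_dG :: "'a measure \<Rightarrow> ('a \<Rightarrow> ennreal) \<Rightarrow> real measure" where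
  "jump_dG P \<gamma> = interval_measure (jump_cdf P \<gamma>)"

definition jump_tG :: "'a measure \<Rightarrow> ('a \<Rightarrow> ennreal) \<Rightarrow> ennreal" where
  "jump_tG P \<gamma> = (SUP t\<in>{t. 0 \<le> t \<and> jump_cdf P \<gamma> t < 1}. ennreal t)"

definition jump_times :: "'a measure \<Rightarrow> ('a \<Rightarrow> ennreal) \<Rightarrow> real set" where
  "jump_times P \<gamma> = {t. 0 \<le> t \<and> measure P {\<omega> \<in> space P. ennreal t \<le> \<gamma> \<omega>} > 0}"

definition case_B :: "'a measure \<Rightarrow> ('a \<Rightarrow> ennreal) \<Rightarrow> bool" where
  "case_B P \<gamma> \<longleftrightarrow>
     measure P {\<omega> \<in> space P. \<gamma> \<omega> = jump_tG P \<gamma> \<and> jump_tG P \<gamma> < \<infinity>} > 0"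


section \<open>Condition M\<close>

text \<open>
  Functions on \<open>[0, t\<^sub>G)\<close> and on the set \<open>jump_times\<close> are total functions on \<open>real\<close>; the following
  notions only depend on their values on the respective domain.
\<close>

definition L1_loc :: "'a measure \<Rightarrow> ('a \<Rightarrow> ennreal) \<Rightarrow> (real \<Rightarrow> real) set" where
  "L1_loc P \<gamma> =
     {z. z \<in> borel_measurable (restrict_space borel (jump_times P \<gamma>)) \<and>
         (\<forall>t\<in>jump_times P \<gamma>. (\<integral>\<^sup>+s\<in>{0..t}. ennreal \<bar>z s\<bar> \<partial>jump_dG P \<gamma>) < \<infinity>)}"

definition loc_abs_cont :: "'a measure \<Rightarrow> ('a \<Rightarrow> ennreal) \<Rightarrow> (real \<Rightarrow> real) \<Rightarrow> bool" where
  "loc_abs_cont P \<gamma> Z \<longleftrightarrow>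
     (\<exists>z\<in>L1_loc P \<gamma>. \<forall>t\<ge>0. ennreal t < jump_tG P \<gamma> \<longrightarrow>
        Z t = Z 0 + (LINT s:{0<..t}|jump_dG P \<gamma>. z s))"

definition condition_M ::
    "'a measure \<Rightarrow> ('a \<Rightarrow> ennreal) \<Rightarrow> (real \<Rightarrow> real) \<Rightarrow> (real \<Rightarrow> real) \<Rightarrow> bool" where
  "condition_M P \<gamma> F H \<longleftrightarrow>
     loc_abs_cont P \<gamma> F \<and>
     H \<in> L1_loc P \<gamma> \<and>
     (\<forall>t\<ge>0. ennreal t < jump_tG P \<gamma> \<longrightarrow>
        F t * (1 - jump_cdf P \<gamma> t) + (LINT s:{0<..t}|jump_dG P \<gamma>. H s)
          = F 0 * (1 - jump_cdf P \<gamma> 0)) \<and>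
     (case_B P \<gamma> \<longrightarrow>
        (F \<longlongrightarrow> H (enn2real (jump_tG P \<gamma>))) (at_left (enn2real (jump_tG P \<gamma>))))"


section \<open>The representation\<close>

definition generated_sigma :: "'a measure \<Rightarrow> ('a \<Rightarrow> ennreal) \<Rightarrow> 'a measure" where
  "generated_sigma P \<gamma> = vimage_algebra (space P) \<gamma> borel"

text \<open>
  The generalized conditional expectation: \<open>L\<close> need not be integrable, it suffices that the
  conditional expectation of \<open>\<bar>L\<bar>\<close> is finite almost surely. For such \<open>L\<close> the library's
  \<open>real_cond_exp\<close> is by definition the difference of the conditional expectations of the positive
  and the negative part.
\<close>

definition cond_exp_zero :: "'a measure \<Rightarrow> ('a \<Rightarrow> ennreal) \<Rightarrow> ('a \<Rightarrow> real) \<Rightarrow> bool" where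
  "cond_exp_zero P \<gamma> L \<longleftrightarrow>
     (AE \<omega> in P. nn_cond_exp P (generated_sigma P \<gamma>) (\<lambda>\<omega>. ennreal \<bar>L \<omega>\<bar>) \<omega> < \<infinity>) \<and>
     (AE \<omega> in P. real_cond_exp P (generated_sigma P \<gamma>) L \<omega> = 0)"

definition extend_zero :: "real set \<Rightarrow> (real \<Rightarrow> real) \<Rightarrow> ennreal \<Rightarrow> real" where
  "extend_zero S H x = (if x < \<infinity> \<and> enn2real x \<in> S then H (enn2real x) else 0)"

definition single_jump_process ::
    "'a measure \<Rightarrow> ('a \<Rightarrow> ennreal) \<Rightarrow> (real \<Rightarrow> real) \<Rightarrow> (real \<Rightarrow> real) \<Rightarrow> ('a \<Rightarrow> real)
       \<Rightarrow> real \<Rightarrow> 'a \<Rightarrow> real" where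
  "single_jump_process P \<gamma> F H L t \<omega> =
     F t * indicator {\<omega>. ennreal t < \<gamma> \<omega>} \<omega> +
     (extend_zero (jump_times P \<gamma>) H (\<gamma> \<omega>) + L \<omega>) * indicator {\<omega>. \<gamma> \<omega> \<le> ennreal t} \<omega>"

end

theory Submission
  imports Defs
begin

text \<open>
  Before the jump time \<open>\<gamma>\<close> the only information in the single jump filtration is that the jump has
  not happened yet, and from \<open>\<gamma>\<close> on everything is known. Hence an adapted process is a deterministic
  function \<open>F\<close> on \<open>[0, \<gamma>)\<close>, and a martingale, being measurable with respect to the present as soon as
  the jump has occurred, cannot move any more after \<open>\<gamma>\<close>. So a local martingale is
  \<open>M\<^sub>t = F(t) 1\<^bsub>{t < \<gamma>}\<^esub> + J 1\<^bsub>{\<gamma> \<le> t}\<^esub>\<close> for some random variable \<open>J\<close>. Conversely, such a process is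
  constant on \<open>{\<gamma> \<le> s}\<close> after time \<open>s\<close>, and \<open>{s < \<gamma>}\<close> is an atom of the \<open>\<sigma>\<close>-algebra of time \<open>s\<close>.
  For it the martingale property therefore says no more than that its expectation is constant, that is
  \<open>F(t) P(\<gamma> > t) + E[J; 0 < \<gamma> \<le> t] = F(0) P(\<gamma> > 0)\<close>.
  This equation for all \<open>t\<close> in \<open>\<T> = {t. P(\<gamma> \<ge> t) > 0}\<close>, together with integrability of \<open>J\<close> on the
  events \<open>{\<gamma> \<le> t}\<close>, is called \<open>mass_balance F J\<close> below; the proof goes through it.

  \<^item> \<open>condition_M_iff_mass_balance\<close>: for \<open>J = H(\<gamma>)\<close> the mass balance is Condition M. The limit
    required in Case B is exactly the balance at the additional time \<open>t\<^sub>G \<in> \<T>\<close>. The absolute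
    continuity of \<open>F\<close> follows by parts: \<open>d(F P(\<gamma> > \<cdot>)) = - H dG\<close> is equivalent to
    \<open>dF(s) = (F(s) - H(s)) / P(\<gamma> \<ge> s) dG(s)\<close>, where the denominator is positive precisely on \<open>\<T>\<close>.

  \<^item> \<open>mass_balance_imp_local_martingale\<close>: a balanced process is a martingale on each \<open>[0, \<tau>]\<close> with
    \<open>\<tau> \<in> \<T>\<close>. Stopping at \<open>\<tau>\<close> if the jump has not occurred by then, and never otherwise, gives stopping
    times that tend to infinity as \<open>\<tau>\<close> exhausts \<open>\<T>\<close>.

  \<^item> \<open>local_martingale_imp_mass_balance\<close>: a stopping time is deterministic before the jump,
    \<open>min T \<gamma> = min r \<gamma>\<close>, so some member of a localizing sequence stops no earlier than \<open>min t \<gamma>\<close> for a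
    given \<open>t \<in> \<T>\<close>. Up to time \<open>t\<close> the process is then a true martingale, and its expectation is constant.

  \<^item> \<open>mass_balance_decompose\<close> and \<open>mass_balance_add\<close>: the mass balance sees \<open>J\<close> only through its
    conditional expectation given \<open>\<gamma>\<close>. Hence \<open>J\<close> may be replaced by \<open>H(\<gamma>) = E[J|\<gamma>]\<close>, and
    \<open>L' = J - H(\<gamma>)\<close> is an arbitrary locally integrable perturbation with conditional expectation zero.
\<close>

section \<open>Measure-theoretic tools\<close>

text \<open>
  Tails of a dominated family are bounded by the tail integrals of the dominating variable, which
  vanish by dominated convergence.
\<close>

lemma uniformly_integrable_dominated:
  fixes X :: "real \<Rightarrow> 'a \<Rightarrow> real"
  assumes Y: "integrable P Y"
    and dom: "\<And>t. 0 \<le> t \<Longrightarrow> AE \<omega> in P. \<bar>X t \<omega>\<bar> \<le> Y \<omega>"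
  shows "uniformly_integrable P X"
proof -
  note [measurable] = borel_measurable_integrable[OF Y]
  define g where "g K = (LINT \<omega>|P. \<bar>Y \<omega>\<bar> * indicator {\<omega>. K \<le> \<bar>Y \<omega>\<bar>} \<omega>)" for K :: real
  have int: "integrable P (\<lambda>\<omega>. \<bar>Y \<omega>\<bar> * indicator {\<omega>. K \<le> \<bar>Y \<omega>\<bar>} \<omega>)" for K :: real
    by (rule Bochner_Integration.integrable_bound[OF Y]) (auto simp: indicator_def)
  have "(g \<longlongrightarrow> (LINT \<omega>|P. 0)) at_top"
    unfolding g_def
  proof (rule integral_dominated_convergence_at_top[where w="\<lambda>\<omega>. \<bar>Y \<omega>\<bar>"])
    show "AE \<omega> in P. ((\<lambda>K. \<bar>Y \<omega>\<bar> * indicator {\<omega>. K \<le> \<bar>Y \<omega>\<bar>} \<omega>) \<longlongrightarrow> 0) at_top"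
    proof (rule AE_I2)
      fix \<omega>
      show "((\<lambda>K. \<bar>Y \<omega>\<bar> * indicator {\<omega>. K \<le> \<bar>Y \<omega>\<bar>} \<omega>) \<longlongrightarrow> 0) at_top"
        by (rule tendsto_eventually)
          (use eventually_gt_at_top[of "\<bar>Y \<omega>\<bar>"] in \<open>eventually_elim, simp\<close>)
    qed
  qed (use Y in \<open>auto simp: indicator_def\<close>)
  then have g: "((\<lambda>K. ennreal (g K)) \<longlongrightarrow> 0) at_top"
    using tendsto_ennrealI[of g 0] by simp
  have le: "(SUP t\<in>{0..}. \<integral>\<^sup>+\<omega>. ennreal \<bar>X t \<omega>\<bar> * indicator {\<omega>. \<bar>X t \<omega>\<bar> \<ge> K} \<omega> \<partial>P) \<le> ennreal (g K)" for K
  proof (rule SUP_least)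
    fix t :: real assume "t \<in> {0..}"
    then have "AE \<omega> in P. \<bar>X t \<omega>\<bar> \<le> Y \<omega>" using dom by simp
    then have "(\<integral>\<^sup>+\<omega>. ennreal \<bar>X t \<omega>\<bar> * indicator {\<omega>. \<bar>X t \<omega>\<bar> \<ge> K} \<omega> \<partial>P) \<le>
        (\<integral>\<^sup>+\<omega>. ennreal (\<bar>Y \<omega>\<bar> * indicator {\<omega>. K \<le> \<bar>Y \<omega>\<bar>} \<omega>) \<partial>P)"
      by (intro nn_integral_mono_AE, eventually_elim) (auto simp: indicator_def intro!: ennreal_leI)
    also have "\<dots> = ennreal (g K)"
      unfolding g_def by (rule nn_integral_eq_integral[OF int]) simp
    finally show "(\<integral>\<^sup>+\<omega>. ennreal \<bar>X t \<omega>\<bar> * indicator {\<omega>. \<bar>X t \<omega>\<bar> \<ge> K} \<omega> \<partial>P) \<le> ennreal (g K)" .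
  qed
  show ?thesis
    unfolding uniformly_integrable_def
    by (rule tendsto_sandwich[OF _ _ tendsto_const g]) (use le in \<open>auto intro!: always_eventually\<close>)
qed

text \<open>
  The Doob--Dynkin factorization, by the standard induction over nonnegative measurable functions.
  It turns a conditional expectation given \<open>\<gamma>\<close> into a function of \<open>\<gamma>\<close>.
\<close>

lemma measurable_vimage_algebra_factor:
  fixes u :: "'a \<Rightarrow> ennreal"
  assumes f: "f \<in> X \<rightarrow> space N" and u: "u \<in> borel_measurable (vimage_algebra X f N)"
  shows "\<exists>h\<in>borel_measurable N. \<forall>x\<in>X. u x = h (f x)"
  using u
proof (induction rule: borel_measurable_induct)
  case (cong u v)
  then obtain h where h: "h \<in> borel_measurable N" "\<forall>x\<in>X. v x = h (f x)" by metis
  moreover have "\<forall>x\<in>X. u x = v x" using cong(3) by (simp add: space_vimage_algebra)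
  ultimately show ?case by (intro bexI[of _ h]) simp_all
next
  case (set A)
  then obtain B where B: "B \<in> sets N" "A = f -` B \<inter> X"
    unfolding sets_vimage_algebra2[OF f] by blast
  show ?case
  proof (intro bexI[of _ "indicator B"] ballI)
    show "indicator A x = indicator B (f x)" if "x \<in> X" for x
      using B that by (simp add: indicator_def)
  qed (use B in simp)
next
  case (mult u c)
  then obtain h where h: "h \<in> borel_measurable N" "\<forall>x\<in>X. u x = h (f x)" by metis
  show ?case
    by (intro bexI[of _ "\<lambda>y. c * h y"]) (use h in simp_all)
next
  case (add u v)
  then obtain h k where h: "h \<in> borel_measurable N" "\<forall>x\<in>X. u x = h (f x)"
    and k: "k \<in> borel_measurable N" "\<forall>x\<in>X. v x = k (f x)" by metis
  show ?case
    by (intro bexI[of _ "\<lambda>y. k y + h y"]) (use h k in simp_all)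
next
  case (seq U)
  then have "\<forall>i. \<exists>h\<in>borel_measurable N. \<forall>x\<in>X. U i x = h (f x)" by blast
  then obtain h where h: "\<And>i. h i \<in> borel_measurable N" "\<And>i x. x \<in> X \<Longrightarrow> U i x = h i (f x)" by metis
  show ?case
  proof (intro bexI[of _ "\<lambda>y. SUP i. h i y"] ballI)
    show "(SUP i. U i) x = (SUP i. h i (f x))" if "x \<in> X" for x
      using h(2)[OF that] by (simp add: SUP_apply image_comp)
  qed (intro borel_measurable_SUP h; simp)
qed

text \<open>
  Exactly one cell \<open>(i \<delta>, (i + 1) \<delta>]\<close> contains a given positive number. The cells are half-open on the
  left because \<open>dG\<close> is integrated over intervals of this kind.
\<close>

lemma partition_index:
  fixes \<delta> x :: real
  assumes "0 < \<delta>" "0 < x"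
  obtains i :: nat where "real i * \<delta> < x" "x \<le> real (Suc i) * \<delta>"
    "\<And>j. real j * \<delta> < x \<and> x \<le> real (Suc j) * \<delta> \<longleftrightarrow> j = i"
proof -
  define i where "i = nat (\<lceil>x / \<delta>\<rceil> - 1)"
  have pos: "0 < x / \<delta>" using assms by simp
  then have "1 \<le> \<lceil>x / \<delta>\<rceil>" by linarith
  then have i: "real i = of_int \<lceil>x / \<delta>\<rceil> - 1" by (simp add: i_def)
  have i': "real i < x / \<delta>" "x / \<delta> \<le> real i + 1"
    unfolding i by linarith+
  have *: "real j * \<delta> < x \<and> x \<le> real (Suc j) * \<delta> \<longleftrightarrow> real j < x / \<delta> \<and> x / \<delta> \<le> real j + 1" for j :: nat
    using assms by (simp add: field_simps)
  have u: "j = i" if "real j < x / \<delta>" "x / \<delta> \<le> real j + 1" for j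
  proof -
    have "real j < real i + 1" "real i < real j + 1" using that i' by linarith+
    then show ?thesis by linarith
  qed
  show ?thesis
    by (rule that[of i]) (use i' * u in blast)+
qed

section \<open>The law of the jump time\<close>

locale single_jump = prob_space P for P :: "'a measure" +
  fixes \<gamma> :: "'a \<Rightarrow> ennreal"
  assumes jump_time_measurable [measurable]: "\<gamma> \<in> borel_measurable P"
    and jump_time_pos: "measure P {\<omega> \<in> space P. \<gamma> \<omega> > 0} > 0"
begin

abbreviation "\<T> \<equiv> jump_times P \<gamma>"
abbreviation "t\<^sub>G \<equiv> jump_tG P \<gamma>"

definition surv :: "real \<Rightarrow> real" where
  "surv t = prob {\<omega> \<in> space P. ennreal t < \<gamma> \<omega>}"

definition jump_value :: "(real \<Rightarrow> real) \<Rightarrow> 'a \<Rightarrow> real" where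
  "jump_value H \<omega> = extend_zero \<T> H (\<gamma> \<omega>)"

lemma one_minus_cdf: "0 \<le> t \<Longrightarrow> 1 - jump_cdf P \<gamma> t = surv t"
  unfolding jump_cdf_def surv_def
  using prob_compl[of "{\<omega> \<in> space P. \<gamma> \<omega> \<le> ennreal t}"]
  by (auto simp: not_le set_diff_eq cong: conj_cong)

lemma surv_nonneg: "0 \<le> surv t"
  by (simp add: surv_def)

lemma surv_antimono: "s \<le> t \<Longrightarrow> surv t \<le> surv s"
  unfolding surv_def
  by (intro finite_measure_mono) (auto intro: le_less_trans[OF ennreal_leI])

lemma surv_0_pos: "0 < surv 0"
  using jump_time_pos by (simp add: surv_def)

text \<open>
  The Lebesgue--Stieltjes measure \<open>dG\<close> is the law of \<open>\<gamma>\<close> restricted to \<open>{\<gamma> < \<infinity>}\<close>, since both finite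
  measures have distribution function \<open>G\<close>. With this, all integrals against \<open>dG\<close> become expectations,
  and \<open>dG\<close> does not reappear until the definitions of the statement are unfolded.
\<close>

lemma jump_dG_eq_distr:
  "jump_dG P \<gamma> =
     distr (density P (indicator {\<omega> \<in> space P. \<gamma> \<omega> < \<infinity>})) borel (\<lambda>\<omega>. enn2real (\<gamma> \<omega>))"
proof -
  define D where "D = {\<omega> \<in> space P. \<gamma> \<omega> < \<infinity>}"
  have D [measurable]: "D \<in> sets P"
    unfolding D_def by measurable
  define N where "N = distr (density P (indicator D)) borel (\<lambda>\<omega>. enn2real (\<gamma> \<omega>))"
  have N_eq: "emeasure N A = emeasure P (D \<inter> ((\<lambda>\<omega>. enn2real (\<gamma> \<omega>)) -` A \<inter> space P))"
    if [measurable]: "A \<in> sets borel" for A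
    unfolding N_def by (subst emeasure_distr) (auto simp: emeasure_restricted space_density)
  have "finite_measure N"
    by standard (simp add: N_def[THEN arg_cong[where f=space]] N_eq)
  then interpret N: finite_borel_measure N
    by (simp add: finite_borel_measure_def finite_borel_measure_axioms_def N_def)
  have cdf: "cdf N = jump_cdf P \<gamma>"
  proof
    fix t :: real
    have "x < \<infinity> \<and> enn2real x \<le> t \<longleftrightarrow> \<not> t < 0 \<and> x \<le> ennreal t" for x :: ennreal
      by (cases x) (auto simp: ennreal_le_iff2 top_unique)
    then have "D \<inter> ((\<lambda>\<omega>. enn2real (\<gamma> \<omega>)) -` {..t} \<inter> space P) =
        (if t < 0 then {} else {\<omega> \<in> space P. \<gamma> \<omega> \<le> ennreal t})"
      by (auto simp: D_def)
    then show "cdf N t = jump_cdf P \<gamma> t"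
      by (simp add: cdf_def jump_cdf_def measure_def N_eq)
  qed
  have cdf2: "cdf (interval_measure (jump_cdf P \<gamma>)) = jump_cdf P \<gamma>"
    unfolding cdf[symmetric]
    by (intro cdf_interval_measure N.cdf_nondecreasing N.cdf_is_right_cont N.cdf_lim_at_bot)
  have "finite_borel_measure (interval_measure (cdf N))"
    by (rule finite_borel_measure_interval_measure[OF N.cdf_nondecreasing N.cdf_is_right_cont
        N.cdf_lim_at_bot N.cdf_lim_at_top measure_nonneg])
  then have "interval_measure (jump_cdf P \<gamma>) = N"
    by (intro cdf_unique') (simp_all add: cdf cdf2 N.finite_borel_measure_axioms)
  then show ?thesis
    by (simp add: jump_dG_def N_def D_def)
qed

lemma nn_integral_dG:
  assumes [measurable]: "f \<in> borel_measurable borel"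
  shows "(\<integral>\<^sup>+s. f s \<partial>jump_dG P \<gamma>) =
    (\<integral>\<^sup>+\<omega>. f (enn2real (\<gamma> \<omega>)) * indicator {\<omega>. \<gamma> \<omega> < \<infinity>} \<omega> \<partial>P)"
proof -
  have [measurable]: "{\<omega> \<in> space P. \<gamma> \<omega> < \<infinity>} \<in> sets P"
    by measurable
  show ?thesis
    unfolding jump_dG_eq_distr
    by (subst nn_integral_distr, measurable, subst nn_integral_density, measurable)
      (auto intro!: nn_integral_cong simp: indicator_def)
qed

lemma integral_dG:
  fixes f :: "real \<Rightarrow> real"
  assumes [measurable]: "f \<in> borel_measurable borel"
  shows "(LINT s|jump_dG P \<gamma>. f s) =
    (LINT \<omega>|P. f (enn2real (\<gamma> \<omega>)) * indicator {\<omega>. \<gamma> \<omega> < \<infinity>} \<omega>)"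
proof -
  have [measurable]: "{\<omega> \<in> space P. \<gamma> \<omega> < \<infinity>} \<in> sets P"
    by measurable
  have "density P (indicator {\<omega> \<in> space P. \<gamma> \<omega> < \<infinity>}) =
     density P (\<lambda>\<omega>. ennreal (indicator {\<omega> \<in> space P. \<gamma> \<omega> < \<infinity>} \<omega>))"
    by (simp add: ennreal_indicator)
  then show ?thesis
    unfolding jump_dG_eq_distr
    by (simp, subst integral_distr, measurable, subst integral_density)
      (auto intro!: Bochner_Integration.integral_cong simp: indicator_def)
qed

section \<open>The survival function and the time set\<close>

lemma zero_in_times: "0 \<in> \<T>"
  by (simp add: jump_times_def prob_space)

lemma times_nonneg: "t \<in> \<T> \<Longrightarrow> 0 \<le> t"
  by (simp add: jump_times_def)

lemma times_downward: "t \<in> \<T> \<Longrightarrow> 0 \<le> s \<Longrightarrow> s \<le> t \<Longrightarrow> s \<in> \<T>"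
  unfolding jump_times_def
  by (auto elim!: less_le_trans intro!: finite_measure_mono intro: order_trans[OF ennreal_leI])

lemma surv_pos_in_times:
  assumes "0 \<le> t" "0 < surv t" shows "t \<in> \<T>"
proof -
  have "surv t \<le> prob {\<omega> \<in> space P. ennreal t \<le> \<gamma> \<omega>}"
    unfolding surv_def by (intro finite_measure_mono) auto
  with assms show ?thesis by (simp add: jump_times_def)
qed

text \<open>
  \<open>t\<^sub>G\<close> is a supremum, and the set of which it is the supremum has no largest element: by continuity of
  \<open>P\<close> from below, \<open>P(\<gamma> > t) > 0\<close> implies \<open>P(\<gamma> > t') > 0\<close> for some \<open>t' > t\<close>.
\<close>

lemma surv_pos_iff:
  assumes "0 \<le> t"
  shows "0 < surv t \<longleftrightarrow> ennreal t < t\<^sub>G"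
proof
  assume "ennreal t < t\<^sub>G"
  then obtain t' where t': "0 \<le> t'" "jump_cdf P \<gamma> t' < 1" "ennreal t < ennreal t'"
    unfolding jump_tG_def less_SUP_iff by auto
  from t' have "t \<le> t'" by (simp add: ennreal_less_iff assms less_imp_le)
  moreover have "0 < surv t'" using t' one_minus_cdf[of t'] by simp
  ultimately show "0 < surv t" using surv_antimono[of t t'] by linarith
next
  assume "0 < surv t"
  have "\<exists>n. 0 < surv (t + 1 / Suc n)"
  proof (rule ccontr)
    \<comment> \<open>otherwise \<open>{\<gamma> > t}\<close> is a countable union of null sets\<close>
    assume "\<nexists>n. 0 < surv (t + 1 / Suc n)"
    then have z: "surv (t + 1 / Suc n) = 0" for n
      using surv_nonneg by (metis less_eq_real_def)
    have "AE \<omega> in P. \<not> ennreal (t + 1 / Suc n) < \<gamma> \<omega>" for n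
      using z[of n] unfolding surv_def by (subst AE_iff_measurable[OF _ refl]) (auto simp: emeasure_eq_measure)
    then have "AE \<omega> in P. \<forall>n. \<not> ennreal (t + 1 / Suc n) < \<gamma> \<omega>"
      by (simp add: AE_all_countable)
    moreover have "\<exists>n. ennreal (t + 1 / Suc n) < x" if "ennreal t < x" for x
    proof (cases x)
      case (real r)
      then have "t < r" using that assms by (simp add: ennreal_less_iff)
      then obtain n where "1 / Suc n < r - t"
        using nat_approx_posE[of "r - t"] by auto
      then show ?thesis using real assms by (intro exI[of _ n]) (simp add: ennreal_less_iff del: ennreal_plus)
    qed simp
    ultimately have "AE \<omega> in P. \<not> ennreal t < \<gamma> \<omega>"
      by (elim AE_mp[OF _ AE_I2]) blast
    then have "surv t = 0"
      unfolding surv_def by (subst (asm) AE_iff_measurable[OF _ refl]) (auto simp: emeasure_eq_measure)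
    then show False using \<open>0 < surv t\<close> by simp
  qed
  then obtain n where n: "0 < surv (t + 1 / Suc n)" by auto
  have "ennreal t < ennreal (t + 1 / Suc n)" using assms by (simp add: ennreal_less_iff)
  also have "\<dots> \<le> t\<^sub>G"
    unfolding jump_tG_def using n one_minus_cdf[of "t + 1 / Suc n"] assms
    by (intro SUP_upper) simp
  finally show "ennreal t < t\<^sub>G" .
qed

lemma before_tG_in_times: "0 \<le> t \<Longrightarrow> ennreal t < t\<^sub>G \<Longrightarrow> t \<in> \<T>"
  using surv_pos_iff surv_pos_in_times by blast

lemma surv_eq_0: "0 \<le> t \<Longrightarrow> t\<^sub>G \<le> ennreal t \<Longrightarrow> surv t = 0"
  using surv_pos_iff[of t] surv_nonneg[of t] by (auto simp: not_less[symmetric])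

lemma case_BE:
  assumes "case_B P \<gamma>"
  obtains g where "0 < g" "t\<^sub>G = ennreal g" "g \<in> \<T>" "0 < prob {\<omega> \<in> space P. \<gamma> \<omega> = ennreal g}"
proof -
  have pos: "0 < prob {\<omega> \<in> space P. \<gamma> \<omega> = t\<^sub>G \<and> t\<^sub>G < \<infinity>}"
    using assms by (simp add: case_B_def)
  have "t\<^sub>G < \<infinity>"
  proof (rule ccontr)
    assume "\<not> t\<^sub>G < \<infinity>"
    then show False using pos by simp
  qed
  then obtain g where g: "0 \<le> g" "t\<^sub>G = ennreal g" by (cases "t\<^sub>G") auto
  have "0 < g" using surv_pos_iff[of 0] surv_0_pos g by simp
  moreover have p: "0 < prob {\<omega> \<in> space P. \<gamma> \<omega> = ennreal g}"
    using pos g by simp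
  moreover have "prob {\<omega> \<in> space P. \<gamma> \<omega> = ennreal g} \<le> prob {\<omega> \<in> space P. ennreal g \<le> \<gamma> \<omega>}"
    by (intro finite_measure_mono) auto
  ultimately show ?thesis using g that by (simp add: jump_times_def)
qed

text \<open>
  No mass of \<open>\<gamma>\<close> lies beyond \<open>t\<^sub>G\<close>, so only an atom at \<open>t\<^sub>G\<close> can bring this time into \<open>\<T>\<close>.
\<close>

lemma times_cases:
  assumes "t \<in> \<T>"
  obtains "ennreal t < t\<^sub>G" | "case_B P \<gamma>" "t\<^sub>G = ennreal t"
proof (cases "ennreal t < t\<^sub>G")
  case False
  have t: "0 \<le> t" "0 < prob {\<omega> \<in> space P. ennreal t \<le> \<gamma> \<omega>}"
    using assms by (auto simp: jump_times_def)
  have "ennreal t \<le> t\<^sub>G"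
  proof (rule ccontr)
    assume "\<not> ennreal t \<le> t\<^sub>G"
    then have "t\<^sub>G < ennreal t" by simp
    then obtain s where s: "t\<^sub>G < ennreal s" "ennreal s < ennreal t" "0 \<le> s"
      using dense[of "t\<^sub>G" "ennreal t"] by (metis enn2real_nonneg ennreal_enn2real ennreal_less_top less_trans)
    have "prob {\<omega> \<in> space P. ennreal t \<le> \<gamma> \<omega>} \<le> surv s"
      unfolding surv_def using s by (intro finite_measure_mono) auto
    then show False using t surv_eq_0[of s] s by simp
  qed
  then have eq: "t\<^sub>G = ennreal t" using False by simp
  have "prob {\<omega> \<in> space P. ennreal t \<le> \<gamma> \<omega>} = prob ({\<omega> \<in> space P. \<gamma> \<omega> = ennreal t} \<union> {\<omega> \<in> space P. ennreal t < \<gamma> \<omega>})"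
    by (intro arg_cong[where f=prob]) auto
  also have "\<dots> \<le> prob {\<omega> \<in> space P. \<gamma> \<omega> = ennreal t} + surv t"
    unfolding surv_def by (intro measure_subadditive) auto
  finally have "case_B P \<gamma>"
    using surv_eq_0[of t] t eq by (simp add: case_B_def)
  with eq that show ?thesis by blast
qed

text \<open>
  Up to a null set the jump takes place in \<open>\<T>\<close> or never. In Case A with finite \<open>t\<^sub>G\<close> this uses that \<open>\<gamma>\<close> does
  not charge \<open>t\<^sub>G\<close>.
\<close>

lemma AE_jump_in_times: "AE \<omega> in P. \<gamma> \<omega> = \<infinity> \<or> (\<gamma> \<omega> < \<infinity> \<and> enn2real (\<gamma> \<omega>) \<in> \<T>)"
proof (cases "t\<^sub>G = \<infinity>")
  case True
  have "x = \<infinity> \<or> (x < \<infinity> \<and> enn2real x \<in> \<T>)" for x :: ennreal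
    using before_tG_in_times[of "enn2real x"] True by (cases x) auto
  then show ?thesis by simp
next
  case False
  then obtain g where g: "0 \<le> g" "t\<^sub>G = ennreal g" by (cases "t\<^sub>G") auto
  have "surv g = 0" using surv_eq_0 g by simp
  then have le: "AE \<omega> in P. \<gamma> \<omega> \<le> ennreal g"
    unfolding surv_def by (subst AE_iff_measurable[OF _ refl]) (auto simp: emeasure_eq_measure not_le)
  have *: "x < \<infinity> \<and> enn2real x \<in> \<T>" if "x \<le> ennreal g" "g \<in> \<T> \<or> x \<noteq> ennreal g" for x :: ennreal
  proof (cases x)
    case (real r)
    then have "r \<le> g" "g \<in> \<T> \<or> r < g" using that g by (auto simp: ennreal_less_iff)
    then show ?thesis using real before_tG_in_times[of r] g times_downward[of g r]
      by (auto simp: ennreal_less_iff)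
  qed (use that in \<open>auto simp: top_unique\<close>)
  show ?thesis
  proof (cases "case_B P \<gamma>")
    case True
    then have "g \<in> \<T>" using g by (auto elim!: case_BE)
    from le show ?thesis by eventually_elim (use * \<open>g \<in> \<T>\<close> in blast)
  next
    case False
    then have "prob {\<omega> \<in> space P. \<gamma> \<omega> = ennreal g} = 0"
      using g measure_nonneg[of P "{\<omega> \<in> space P. \<gamma> \<omega> = ennreal g}"] by (simp add: case_B_def)
    then have "AE \<omega> in P. \<gamma> \<omega> \<noteq> ennreal g"
      by (subst AE_iff_measurable[OF _ refl]) (auto simp: emeasure_eq_measure)
    with le show ?thesis by eventually_elim (use * in blast)
  qed
qed

text \<open>
  \<open>\<T>\<close> is a half-open or closed interval; a single sequence that exhausts it in either case makes it
  possible to treat Case A and Case B together. If \<open>\<T>\<close> has no maximum, an enumeration of its rational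
  points is used.
\<close>

lemma times_cofinal:
  obtains \<tau> :: "nat \<Rightarrow> real" where "incseq \<tau>" "range \<tau> \<subseteq> \<T>" "\<And>t. t \<in> \<T> \<Longrightarrow> \<exists>n. t \<le> \<tau> n"
proof (cases "\<exists>m\<in>\<T>. \<forall>t\<in>\<T>. t \<le> m")
  case True
  then obtain m where "m \<in> \<T>" "\<forall>t\<in>\<T>. t \<le> m" by auto
  then show ?thesis by (intro that[of "\<lambda>_. m"]) (auto simp: incseq_def)
next
  case False
  define D where "D = \<T> \<inter> \<rat>"
  have D: "countable D" "D \<noteq> {}"
    using countable_rat zero_in_times by (auto simp: D_def)
  define \<tau> where "\<tau> n = Max (from_nat_into D ` {..n})" for n :: nat
  have in_D: "\<tau> n \<in> D" for n
  proof -
    have "\<tau> n \<in> from_nat_into D ` {..n}"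
      unfolding \<tau>_def by (rule Max_in) auto
    then show ?thesis using from_nat_into[OF D(2)] by auto
  qed
  show ?thesis
  proof (rule that)
    show "incseq \<tau>" unfolding \<tau>_def incseq_def by (auto intro!: Max_mono)
    show "range \<tau> \<subseteq> \<T>" using in_D by (auto simp: D_def)
    fix t assume "t \<in> \<T>"
    with False obtain t' where t': "t' \<in> \<T>" "t < t'" by (auto simp: not_le)
    obtain q where q: "q \<in> \<rat>" "t < q" "q < t'" using Rats_dense_in_real[OF t'(2)] by auto
    then have "q \<in> D" using times_downward[OF t'(1), of q] times_nonneg[OF \<open>t \<in> \<T>\<close>] by (simp add: D_def)
    then obtain n where "from_nat_into D n = q"
      using from_nat_into_surj[OF D(1)] by auto
    then have "q \<le> \<tau> n" unfolding \<tau>_def by (intro Max_ge) auto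
    with q show "\<exists>n. t \<le> \<tau> n" by (intro exI[of _ n]) simp
  qed
qed

lemma times_borel [measurable]: "\<T> \<in> sets borel"
  by (rule real_interval_borel_measurable)
    (use times_downward times_nonneg order_trans in \<open>unfold is_interval_1, blast\<close>)

lemma jump_value_eq: "\<gamma> \<omega> \<le> ennreal t \<Longrightarrow> t \<in> \<T> \<Longrightarrow> jump_value H \<omega> = H (enn2real (\<gamma> \<omega>))"
proof -
  assume *: "\<gamma> \<omega> \<le> ennreal t" "t \<in> \<T>"
  then have "\<gamma> \<omega> < \<infinity>" by (auto intro: le_less_trans)
  moreover have "enn2real (\<gamma> \<omega>) \<le> t"
    using * times_nonneg by (cases "\<gamma> \<omega>") (auto simp: top_unique)
  ultimately show ?thesis
    using times_downward[OF *(2), of "enn2real (\<gamma> \<omega>)"] by (simp add: jump_value_def extend_zero_def)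
qed

abbreviation "borel_\<T> \<equiv> restrict_space borel \<T>"

lemma measurable_borel_times:
  fixes H :: "real \<Rightarrow> real"
  shows "H \<in> borel_measurable borel_\<T> \<longleftrightarrow> (\<lambda>s. indicator \<T> s * H s) \<in> borel_measurable borel"
  by (subst borel_measurable_restrict_space_iff) auto

lemma jump_value_measurable [measurable]:
  assumes "H \<in> borel_measurable borel_\<T>"
  shows "jump_value H \<in> borel_measurable P"
proof -
  note [measurable] = assms[unfolded measurable_borel_times]
  have "jump_value H = (\<lambda>\<omega>. if \<gamma> \<omega> < \<infinity> then indicator \<T> (enn2real (\<gamma> \<omega>)) * H (enn2real (\<gamma> \<omega>)) else 0)"
    by (auto simp: jump_value_def extend_zero_def fun_eq_iff)
  also have "\<dots> \<in> borel_measurable P"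
    by measurable
  finally show ?thesis .
qed

lemma set_nn_integral_dG:
  assumes H: "H \<in> borel_measurable borel_\<T>" and t: "t \<in> \<T>"
  shows "(\<integral>\<^sup>+s\<in>{0..t}. ennreal \<bar>H s\<bar> \<partial>jump_dG P \<gamma>) =
    (\<integral>\<^sup>+\<omega>. ennreal \<bar>jump_value H \<omega>\<bar> * indicator {\<omega>. \<gamma> \<omega> \<le> ennreal t} \<omega> \<partial>P)"
proof -
  note [measurable] = H[unfolded measurable_borel_times]
  have "(\<integral>\<^sup>+s\<in>{0..t}. ennreal \<bar>H s\<bar> \<partial>jump_dG P \<gamma>) =
    (\<integral>\<^sup>+s. ennreal \<bar>indicator \<T> s * H s\<bar> * indicator {0..t} s \<partial>jump_dG P \<gamma>)"
    using times_downward[OF t] by (intro nn_integral_cong) (auto simp: indicator_def)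
  also have "\<dots> = (\<integral>\<^sup>+\<omega>. ennreal \<bar>jump_value H \<omega>\<bar> * indicator {\<omega>. \<gamma> \<omega> \<le> ennreal t} \<omega> \<partial>P)"
  proof (subst nn_integral_dG, measurable, intro nn_integral_cong)
    fix \<omega>
    show "ennreal \<bar>indicator \<T> (enn2real (\<gamma> \<omega>)) * H (enn2real (\<gamma> \<omega>))\<bar> * indicator {0..t} (enn2real (\<gamma> \<omega>)) *
        indicator {\<omega>. \<gamma> \<omega> < \<infinity>} \<omega> = ennreal \<bar>jump_value H \<omega>\<bar> * indicator {\<omega>. \<gamma> \<omega> \<le> ennreal t} \<omega>"
      using times_nonneg[OF t]
      by (cases "\<gamma> \<omega>") (auto simp: jump_value_def extend_zero_def indicator_def top_unique)
  qed
  finally show ?thesis .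
qed

text \<open>
  The condition \<open>0 \<le> a\<close> is essential: for negative \<open>a\<close> the mass of \<open>dG\<close> at \<open>0\<close> lies in \<open>{a<..b}\<close>, but the event
  on the right-hand side excludes \<open>\<gamma> = 0\<close>, since \<open>ennreal a = 0\<close>.
\<close>

lemma set_integral_dG:
  assumes H: "H \<in> borel_measurable borel_\<T>" and a: "0 \<le> a" and b: "b \<in> \<T>"
  shows "(LINT s:{a<..b}|jump_dG P \<gamma>. H s) =
    (LINT \<omega>|P. jump_value H \<omega> * indicator {\<omega>. ennreal a < \<gamma> \<omega> \<and> \<gamma> \<omega> \<le> ennreal b} \<omega>)"
proof -
  note [measurable] = H[unfolded measurable_borel_times]
  have "(LINT s:{a<..b}|jump_dG P \<gamma>. H s) =
    (LINT s|jump_dG P \<gamma>. indicator \<T> s * H s * indicator {a<..b} s)"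
    unfolding set_lebesgue_integral_def using times_downward[OF b] a
    by (intro Bochner_Integration.integral_cong) (auto simp: indicator_def)
  also have "\<dots> = (LINT \<omega>|P. jump_value H \<omega> * indicator {\<omega>. ennreal a < \<gamma> \<omega> \<and> \<gamma> \<omega> \<le> ennreal b} \<omega>)"
  proof (subst integral_dG, measurable, intro Bochner_Integration.integral_cong refl)
    fix \<omega>
    show "indicator \<T> (enn2real (\<gamma> \<omega>)) * H (enn2real (\<gamma> \<omega>)) * indicator {a<..b} (enn2real (\<gamma> \<omega>)) *
        indicator {\<omega>. \<gamma> \<omega> < \<infinity>} \<omega> = jump_value H \<omega> * indicator {\<omega>. ennreal a < \<gamma> \<omega> \<and> \<gamma> \<omega> \<le> ennreal b} \<omega>"
      using times_nonneg[OF b] a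
      by (cases "\<gamma> \<omega>") (auto simp: jump_value_def extend_zero_def indicator_def top_unique ennreal_less_iff)
  qed
  finally show ?thesis .
qed

definition jump_integrable :: "('a \<Rightarrow> real) \<Rightarrow> bool" where
  "jump_integrable J \<longleftrightarrow> J \<in> borel_measurable P \<and>
     (\<forall>t\<in>\<T>. integrable P (\<lambda>\<omega>. J \<omega> * indicator {\<omega>. \<gamma> \<omega> \<le> ennreal t} \<omega>))"

lemma jump_integrableD:
  assumes "jump_integrable J"
  shows "J \<in> borel_measurable P"
    and "t \<in> \<T> \<Longrightarrow> integrable P (\<lambda>\<omega>. J \<omega> * indicator {\<omega>. \<gamma> \<omega> \<le> ennreal t} \<omega>)"
  using assms by (auto simp: jump_integrable_def)

lemma L1_loc_iff:
  "H \<in> L1_loc P \<gamma> \<longleftrightarrow> H \<in> borel_measurable borel_\<T> \<and> jump_integrable (jump_value H)"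
proof -
  have "integrable P (\<lambda>\<omega>. jump_value H \<omega> * indicator {\<omega>. \<gamma> \<omega> \<le> ennreal t} \<omega>) \<longleftrightarrow>
     (\<integral>\<^sup>+s\<in>{0..t}. ennreal \<bar>H s\<bar> \<partial>jump_dG P \<gamma>) < \<infinity>"
    if t: "t \<in> \<T>" and H: "H \<in> borel_measurable borel_\<T>" for t
  proof -
    note [measurable] = jump_value_measurable[OF H]
    show ?thesis
      unfolding set_nn_integral_dG[OF H t] integrable_iff_bounded
      by (auto simp: abs_mult ennreal_mult ennreal_indicator)
  qed
  then show ?thesis by (auto simp: L1_loc_def jump_integrable_def)
qed

section \<open>One-sided limits of truncated expectations\<close>

text \<open>
  The limits in this part are dominated convergence. Together with its counterpart from the right
  the lemma yields all one-sided limits needed later: those of the survival function (\<open>Y = 1\<close>) and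
  of the expected jump.
\<close>

lemma tendsto_expectation_at_left:
  fixes Y :: "'a \<Rightarrow> real"
  assumes Y: "integrable P Y" and x: "0 < x"
  shows "((\<lambda>s. LINT \<omega>|P. Y \<omega> * indicator {\<omega>. \<gamma> \<omega> \<le> ennreal s} \<omega>) \<longlongrightarrow>
      (LINT \<omega>|P. Y \<omega> * indicator {\<omega>. \<gamma> \<omega> < ennreal x} \<omega>)) (at_left x)"
proof (rule tendsto_at_left_sequentially[of "x - 1"])
  fix f :: "nat \<Rightarrow> real"
  assume f: "\<And>n. f n < x" "f \<longlonglongrightarrow> x"
  note [measurable] = borel_measurable_integrable[OF Y]
  show "(\<lambda>n. LINT \<omega>|P. Y \<omega> * indicator {\<omega>. \<gamma> \<omega> \<le> ennreal (f n)} \<omega>) \<longlonglongrightarrow>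
      (LINT \<omega>|P. Y \<omega> * indicator {\<omega>. \<gamma> \<omega> < ennreal x} \<omega>)"
  proof (rule integral_dominated_convergence[where w="\<lambda>\<omega>. \<bar>Y \<omega>\<bar>"])
    have "\<forall>\<^sub>F n in sequentially. indicator {\<omega>. \<gamma> \<omega> \<le> ennreal (f n)} \<omega> = (indicator {\<omega>. \<gamma> \<omega> < ennreal x} \<omega> :: real)" for \<omega>
    proof (cases "\<gamma> \<omega> < ennreal x")
      case True
      then obtain r where r: "\<gamma> \<omega> = ennreal r" "0 \<le> r" "r < x"
        by (cases "\<gamma> \<omega>") (auto simp: ennreal_less_iff)
      show ?thesis
        using order_tendstoD(1)[OF f(2) r(3)] by eventually_elim (use r True in \<open>auto intro: ennreal_leI\<close>)
    next
      case False
      have "ennreal (f n) < ennreal x" for n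
        using f(1)[of n] x by (auto simp: ennreal_less_iff not_le intro: ennreal_lessI)
      then have "\<not> \<gamma> \<omega> \<le> ennreal (f n)" for n
        using False by (meson le_less_trans)
      then show ?thesis using False by simp
    qed
    then show "AE \<omega> in P. (\<lambda>n. Y \<omega> * indicator {\<omega>. \<gamma> \<omega> \<le> ennreal (f n)} \<omega>) \<longlonglongrightarrow> Y \<omega> * indicator {\<omega>. \<gamma> \<omega> < ennreal x} \<omega>"
      by (intro AE_I2 tendsto_mult tendsto_const tendsto_eventually) simp
  qed (use Y in \<open>auto simp: indicator_def\<close>)
qed simp

lemma tendsto_expectation_at_right:
  fixes Y :: "'a \<Rightarrow> real"
  assumes Y: "integrable P Y" and x: "0 \<le> x"
  shows "((\<lambda>s. LINT \<omega>|P. Y \<omega> * indicator {\<omega>. \<gamma> \<omega> \<le> ennreal s} \<omega>) \<longlongrightarrow>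
      (LINT \<omega>|P. Y \<omega> * indicator {\<omega>. \<gamma> \<omega> \<le> ennreal x} \<omega>)) (at_right x)"
proof (rule tendsto_at_right_sequentially[of _ "x + 1"])
  fix f :: "nat \<Rightarrow> real"
  assume f: "\<And>n. x < f n" "f \<longlonglongrightarrow> x"
  note [measurable] = borel_measurable_integrable[OF Y]
  show "(\<lambda>n. LINT \<omega>|P. Y \<omega> * indicator {\<omega>. \<gamma> \<omega> \<le> ennreal (f n)} \<omega>) \<longlonglongrightarrow>
      (LINT \<omega>|P. Y \<omega> * indicator {\<omega>. \<gamma> \<omega> \<le> ennreal x} \<omega>)"
  proof (rule integral_dominated_convergence[where w="\<lambda>\<omega>. \<bar>Y \<omega>\<bar>"])
    have "\<forall>\<^sub>F n in sequentially. indicator {\<omega>. \<gamma> \<omega> \<le> ennreal (f n)} \<omega> = (indicator {\<omega>. \<gamma> \<omega> \<le> ennreal x} \<omega> :: real)" for \<omega>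
    proof (cases "\<gamma> \<omega> \<le> ennreal x")
      case True
      have "ennreal x \<le> ennreal (f n)" for n
        using f(1)[of n] by (auto intro: ennreal_leI)
      then have "\<gamma> \<omega> \<le> ennreal (f n)" for n
        using True by (meson order_trans)
      then show ?thesis using True by simp
    next
      case False
      show ?thesis
      proof (cases "\<gamma> \<omega>")
        case (real r)
        then have "x < r" using False x by (auto simp: not_le ennreal_less_iff)
        show ?thesis
          using order_tendstoD(2)[OF f(2) \<open>x < r\<close>]
          by eventually_elim (use real False in \<open>auto simp: indicator_def ennreal_le_iff2\<close>)
      qed (auto simp: top_unique)
    qed
    then show "AE \<omega> in P. (\<lambda>n. Y \<omega> * indicator {\<omega>. \<gamma> \<omega> \<le> ennreal (f n)} \<omega>) \<longlonglongrightarrow> Y \<omega> * indicator {\<omega>. \<gamma> \<omega> \<le> ennreal x} \<omega>"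
      by (intro AE_I2 tendsto_mult tendsto_const tendsto_eventually) simp
  qed (use Y in \<open>auto simp: indicator_def\<close>)
qed simp

definition surv_left :: "real \<Rightarrow> real" where
  "surv_left t = prob {\<omega> \<in> space P. ennreal t \<le> \<gamma> \<omega>}"

lemma surv_eq_expectation: "surv t = 1 - (LINT \<omega>|P. (1::real) * indicator {\<omega>. \<gamma> \<omega> \<le> ennreal t} \<omega>)"
proof -
  have "(LINT \<omega>|P. (1::real) * indicator {\<omega>. \<gamma> \<omega> \<le> ennreal t} \<omega>) = (LINT \<omega>|P. indicator {\<omega> \<in> space P. \<gamma> \<omega> \<le> ennreal t} \<omega>)"
    by (intro Bochner_Integration.integral_cong) (auto simp: indicator_def)
  also have "\<dots> = prob {\<omega> \<in> space P. \<gamma> \<omega> \<le> ennreal t}"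
    by (simp add: Int_absorb2)
  also have "\<dots> = 1 - surv t"
    unfolding surv_def using prob_compl[of "{\<omega> \<in> space P. ennreal t < \<gamma> \<omega>}"]
    by (auto simp: not_less set_diff_eq cong: conj_cong)
  finally show ?thesis by simp
qed

lemma surv_left_eq_expectation: "surv_left t = 1 - (LINT \<omega>|P. (1::real) * indicator {\<omega>. \<gamma> \<omega> < ennreal t} \<omega>)"
proof -
  have "(LINT \<omega>|P. (1::real) * indicator {\<omega>. \<gamma> \<omega> < ennreal t} \<omega>) = (LINT \<omega>|P. indicator {\<omega> \<in> space P. \<gamma> \<omega> < ennreal t} \<omega>)"
    by (intro Bochner_Integration.integral_cong) (auto simp: indicator_def)
  also have "\<dots> = prob {\<omega> \<in> space P. \<gamma> \<omega> < ennreal t}"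
    by (simp add: Int_absorb2)
  also have "\<dots> = 1 - surv_left t"
    unfolding surv_left_def using prob_compl[of "{\<omega> \<in> space P. ennreal t \<le> \<gamma> \<omega>}"]
    by (auto simp: not_le set_diff_eq cong: conj_cong)
  finally show ?thesis by simp
qed

lemma surv_tendsto_left: "0 < x \<Longrightarrow> (surv \<longlongrightarrow> surv_left x) (at_left x)"
  unfolding surv_left_eq_expectation surv_eq_expectation[abs_def]
  by (intro tendsto_diff tendsto_const tendsto_expectation_at_left) auto

lemma surv_tendsto_right: "0 \<le> x \<Longrightarrow> (surv \<longlongrightarrow> surv x) (at_right x)"
  unfolding surv_eq_expectation[abs_def]
  by (intro tendsto_diff tendsto_const tendsto_expectation_at_right) auto

lemma surv_measurable [measurable]: "surv \<in> borel_measurable borel"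
  unfolding surv_eq_expectation[abs_def]
  by (intro borel_measurable_diff borel_measurable_const borel_measurable_lebesgue_integral) measurable

lemma surv_left_measurable [measurable]: "surv_left \<in> borel_measurable borel"
  unfolding surv_left_eq_expectation[abs_def]
  by (intro borel_measurable_diff borel_measurable_const borel_measurable_lebesgue_integral) measurable

lemma surv_left_antimono: "s \<le> t \<Longrightarrow> surv_left t \<le> surv_left s"
  unfolding surv_left_def
  by (intro finite_measure_mono) (auto intro: order_trans[OF ennreal_leI])

lemma surv_left_le_surv: "0 \<le> s \<Longrightarrow> s < t \<Longrightarrow> surv_left t \<le> surv s"
  unfolding surv_left_def surv_def
  by (intro finite_measure_mono) (auto intro: less_le_trans[OF ennreal_lessI[rotated]])

lemma surv_left_pos: "t \<in> \<T> \<Longrightarrow> 0 < surv_left t"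
  by (simp add: jump_times_def surv_left_def)

section \<open>The mass balance\<close>

definition jump_mean :: "('a \<Rightarrow> real) \<Rightarrow> real \<Rightarrow> real" where
  "jump_mean J t = (LINT \<omega>|P. J \<omega> * indicator {\<omega>. 0 < \<gamma> \<omega> \<and> \<gamma> \<omega> \<le> ennreal t} \<omega>)"

text \<open>
  Up to the constant \<open>E[J; \<gamma> = 0]\<close> the left-hand side is the expectation at time \<open>t\<close> of the process that
  equals \<open>F\<close> before the jump and \<open>J\<close> from the jump on, see \<open>expectation_jump_process\<close>. In Case B
  the equation at \<open>t\<^sub>G\<close>, where \<open>surv t\<^sub>G = 0\<close>, says that the expected jump uses up the whole right-hand side.
\<close>

definition mass_balance :: "(real \<Rightarrow> real) \<Rightarrow> ('a \<Rightarrow> real) \<Rightarrow> bool" where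
  "mass_balance F J \<longleftrightarrow> jump_integrable J \<and>
     (\<forall>t\<in>\<T>. F t * surv t + jump_mean J t = F 0 * surv 0)"

lemma mass_balanceD:
  assumes "mass_balance F J"
  shows "jump_integrable J" and "t \<in> \<T> \<Longrightarrow> F t * surv t + jump_mean J t = F 0 * surv 0"
  using assms by (auto simp: mass_balance_def)

lemma jump_mean_0 [simp]: "jump_mean J 0 = 0"
proof -
  have "{\<omega>. 0 < \<gamma> \<omega> \<and> \<gamma> \<omega> \<le> ennreal 0} = {}" by auto
  then show ?thesis by (simp add: jump_mean_def)
qed

lemma jump_mean_measurable [measurable]:
  assumes [measurable]: "J \<in> borel_measurable P"
  shows "jump_mean J \<in> borel_measurable borel"
  unfolding jump_mean_def[abs_def] by (intro borel_measurable_lebesgue_integral) measurable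

lemma jump_integrable_Ioc:
  assumes J: "jump_integrable J" and t: "t \<in> \<T>"
  shows "integrable P (\<lambda>\<omega>. J \<omega> * indicator {\<omega>. ennreal s < \<gamma> \<omega> \<and> \<gamma> \<omega> \<le> ennreal t} \<omega>)"
proof -
  note [measurable] = jump_integrableD(1)[OF J]
  show ?thesis
    by (rule Bochner_Integration.integrable_bound[OF jump_integrableD(2)[OF J t]])
      (auto simp: indicator_def)
qed

text \<open>
  In the limit a possible atom of \<open>\<gamma>\<close> at \<open>t\<close> is lost.
\<close>

lemma jump_mean_tendsto_left:
  assumes J: "jump_integrable J" and t: "t \<in> \<T>" and "0 < t"
  shows "(jump_mean J \<longlongrightarrow> (LINT \<omega>|P. J \<omega> * indicator {\<omega>. 0 < \<gamma> \<omega> \<and> \<gamma> \<omega> < ennreal t} \<omega>)) (at_left t)"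
proof -
  let ?Y = "\<lambda>\<omega>. J \<omega> * indicator {\<omega>. 0 < \<gamma> \<omega> \<and> \<gamma> \<omega> \<le> ennreal t} \<omega>"
  note [measurable] = jump_integrableD(1)[OF J]
  have int: "integrable P ?Y" using jump_integrable_Ioc[OF J t, of 0] by simp
  have eq: "\<forall>\<^sub>F s in at_left t. (LINT \<omega>|P. ?Y \<omega> * indicator {\<omega>. \<gamma> \<omega> \<le> ennreal s} \<omega>) = jump_mean J s"
  proof (rule eventually_at_leftI[of 0])
    fix s assume "s \<in> {0<..<t}"
    then have "ennreal s \<le> ennreal t" by (auto intro: ennreal_leI)
    then show "(LINT \<omega>|P. ?Y \<omega> * indicator {\<omega>. \<gamma> \<omega> \<le> ennreal s} \<omega>) = jump_mean J s"
      unfolding jump_mean_def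
      by (intro Bochner_Integration.integral_cong) (auto simp: indicator_def)
  qed fact
  have "(LINT \<omega>|P. ?Y \<omega> * indicator {\<omega>. \<gamma> \<omega> < ennreal t} \<omega>) =
      (LINT \<omega>|P. J \<omega> * indicator {\<omega>. 0 < \<gamma> \<omega> \<and> \<gamma> \<omega> < ennreal t} \<omega>)"
    by (intro Bochner_Integration.integral_cong) (auto simp: indicator_def)
  then show ?thesis
    using Lim_transform_eventually[OF tendsto_expectation_at_left[OF int \<open>0 < t\<close>] eq] by simp
qed

lemma jump_mean_tendsto_right:
  assumes J: "jump_integrable J" and t: "0 \<le> t" "ennreal t < t\<^sub>G"
  shows "(jump_mean J \<longlongrightarrow> jump_mean J t) (at_right t)"
proof -
  obtain b where b: "t < b" "b \<in> \<T>"
    using dense[OF t(2)] t before_tG_in_times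
    by (metis enn2real_nonneg ennreal_enn2real ennreal_less_iff ennreal_less_top less_le_trans linorder_not_le order_less_imp_not_less top.extremum_strict not_less_iff_gr_or_eq)
  let ?Y = "\<lambda>\<omega>. J \<omega> * indicator {\<omega>. 0 < \<gamma> \<omega> \<and> \<gamma> \<omega> \<le> ennreal b} \<omega>"
  have int: "integrable P ?Y" using jump_integrable_Ioc[OF J b(2), of 0] by simp
  have eq: "(LINT \<omega>|P. ?Y \<omega> * indicator {\<omega>. \<gamma> \<omega> \<le> ennreal s} \<omega>) = jump_mean J s" if "s \<le> b" for s
    unfolding jump_mean_def using ennreal_leI[OF that]
    by (intro Bochner_Integration.integral_cong) (auto simp: indicator_def)
  have "\<forall>\<^sub>F s in at_right t. (LINT \<omega>|P. ?Y \<omega> * indicator {\<omega>. \<gamma> \<omega> \<le> ennreal s} \<omega>) = jump_mean J s"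
    by (rule eventually_at_rightI[OF _ b(1)], rule eq) simp
  from Lim_transform_eventually[OF tendsto_expectation_at_right[OF int t(1)] this]
  show ?thesis
    by (simp only: eq less_imp_le[OF b(1)])
qed

lemma mass_balance_solve:
  assumes "mass_balance F J" "t \<in> \<T>" "surv t \<noteq> 0"
  shows "F t = (F 0 * surv 0 - jump_mean J t) / surv t"
  using mass_balanceD(2)[OF assms(1,2)] assms(3) by (simp add: field_simps)

lemma jump_mean_bound:
  assumes J: "jump_integrable J" and t: "t \<in> \<T>" "s \<le> t"
  shows "\<bar>jump_mean J s\<bar> \<le> (LINT \<omega>|P. \<bar>J \<omega> * indicator {\<omega>. \<gamma> \<omega> \<le> ennreal t} \<omega>\<bar>)"
  unfolding jump_mean_def
proof (rule order_trans[OF integral_abs_bound] , rule integral_mono_AE')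
  show "AE \<omega> in P. \<bar>J \<omega> * indicator {\<omega>. 0 < \<gamma> \<omega> \<and> \<gamma> \<omega> \<le> ennreal s} \<omega>\<bar> \<le> \<bar>J \<omega> * indicator {\<omega>. \<gamma> \<omega> \<le> ennreal t} \<omega>\<bar>"
    using ennreal_leI[OF t(2)] by (auto simp: indicator_def)
qed (use jump_integrableD(2)[OF J t(1)] in auto)

text \<open>
  For \<open>t = t\<^sub>G\<close> in Case B the survival function vanishes at \<open>t\<close>, but before \<open>t\<close> it stays above
  \<open>P(\<gamma> \<ge> t)\<close>, which is positive on \<open>\<T>\<close>. So a balanced \<open>F\<close> remains bounded up to \<open>t\<^sub>G\<close> in this case.
\<close>

lemma surv_lower_bound:
  assumes t: "t \<in> \<T>"
  obtains m where "0 < m" "\<And>s. 0 \<le> s \<Longrightarrow> s \<le> t \<Longrightarrow> surv s \<noteq> 0 \<Longrightarrow> m \<le> surv s"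
proof
  let ?m = "if surv t = 0 then surv_left t else surv t"
  show "0 < ?m" using surv_left_pos[OF t] surv_nonneg[of t] by simp
  show "?m \<le> surv s" if "0 \<le> s" "s \<le> t" "surv s \<noteq> 0" for s
    using that surv_left_le_surv[of s t] surv_antimono[of s t] by (cases "s = t") auto
qed

lemma mass_balance_bounded:
  assumes "mass_balance F J" "t \<in> \<T>"
  obtains C where "\<And>s. 0 \<le> s \<Longrightarrow> s \<le> t \<Longrightarrow> surv s \<noteq> 0 \<Longrightarrow> \<bar>F s\<bar> \<le> C"
proof -
  note J = mass_balanceD(1)[OF assms(1)]
  obtain m where m: "0 < m" "\<And>s. 0 \<le> s \<Longrightarrow> s \<le> t \<Longrightarrow> surv s \<noteq> 0 \<Longrightarrow> m \<le> surv s"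
    using surv_lower_bound[OF assms(2)] by blast
  define k where "k = (LINT \<omega>|P. \<bar>J \<omega> * indicator {\<omega>. \<gamma> \<omega> \<le> ennreal t} \<omega>\<bar>)"
  show ?thesis
  proof (rule that)
    fix s assume s: "0 \<le> s" "s \<le> t" "surv s \<noteq> 0"
    have "F s = (F 0 * surv 0 - jump_mean J s) / surv s"
      using mass_balance_solve[OF assms(1) times_downward[OF assms(2) s(1,2)] s(3)] .
    then have "\<bar>F s\<bar> = \<bar>F 0 * surv 0 - jump_mean J s\<bar> / surv s"
      by (simp add: surv_nonneg)
    also have "\<dots> \<le> (\<bar>F 0 * surv 0\<bar> + k) / m"
      using jump_mean_bound[OF J assms(2) s(2)] m(1) m(2)[OF s]
      by (intro frac_le) (auto simp: k_def)
    finally show "\<bar>F s\<bar> \<le> (\<bar>F 0 * surv 0\<bar> + k) / m" .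
  qed
qed

lemma mass_balance_tendsto_right:
  assumes F: "mass_balance F J" and t: "0 \<le> t" "ennreal t < t\<^sub>G"
  shows "(F \<longlongrightarrow> F t) (at_right t)"
proof -
  note J = mass_balanceD(1)[OF F]
  have pos: "surv t \<noteq> 0" using surv_pos_iff[OF t(1)] t(2) by linarith
  have "((\<lambda>s. (F 0 * surv 0 - jump_mean J s) / surv s) \<longlongrightarrow> (F 0 * surv 0 - jump_mean J t) / surv t) (at_right t)"
    by (intro tendsto_intros jump_mean_tendsto_right surv_tendsto_right J t pos)
  also have "(F 0 * surv 0 - jump_mean J t) / surv t = F t"
    using mass_balance_solve[OF F before_tG_in_times[OF t] pos] by simp
  finally have lim: "((\<lambda>s. (F 0 * surv 0 - jump_mean J s) / surv s) \<longlongrightarrow> F t) (at_right t)" .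
  have "\<forall>\<^sub>F s in at_right t. 0 < surv s"
    using surv_tendsto_right[OF t(1)] surv_pos_iff t by (intro order_tendstoD) auto
  moreover have "\<forall>\<^sub>F s in at_right t. t < s" by (rule eventually_at_right_less)
  ultimately have "\<forall>\<^sub>F s in at_right t. (F 0 * surv 0 - jump_mean J s) / surv s = F s"
  proof eventually_elim
    case (elim s)
    then show ?case using mass_balance_solve[OF F surv_pos_in_times[of s]] t(1) by simp
  qed
  with lim show ?thesis by (rule Lim_transform_eventually)
qed

section \<open>The integral equation behind Condition M\<close>

text \<open>
  The discrete form of the integration by parts: divide
  \<open>F(b) P(\<gamma> > b) - F(a) P(\<gamma> > a) = - E[J; a < \<gamma> \<le> b]\<close> by \<open>P(\<gamma> > a)\<close>, after writing the left-hand side as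
  \<open>P(\<gamma> > a) (F(b) - F(a)) - F(b) P(a < \<gamma> \<le> b)\<close>.
\<close>

lemma mass_balance_increment:
  assumes F: "mass_balance F J" and ab: "0 \<le> a" "a \<le> b" "ennreal b < t\<^sub>G"
  shows "integrable P (\<lambda>\<omega>. (F b - J \<omega>) / surv a * indicator {\<omega>. ennreal a < \<gamma> \<omega> \<and> \<gamma> \<omega> \<le> ennreal b} \<omega>)"
    and "F b - F a = (LINT \<omega>|P. (F b - J \<omega>) / surv a * indicator {\<omega>. ennreal a < \<gamma> \<omega> \<and> \<gamma> \<omega> \<le> ennreal b} \<omega>)"
proof -
  note J = mass_balanceD(1)[OF F]
  note [measurable] = jump_integrableD(1)[OF J]
  have b: "b \<in> \<T>" using before_tG_in_times[of b] ab by simp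
  have a: "a \<in> \<T>" using times_downward[OF b] ab by simp
  let ?I = "indicator {\<omega>. ennreal a < \<gamma> \<omega> \<and> \<gamma> \<omega> \<le> ennreal b} :: 'a \<Rightarrow> real"
  have "0 < surv b" using surv_pos_iff[of b] ab by simp
  then have pos: "0 < surv a" using surv_antimono[OF ab(2)] by simp
  have int1: "integrable P ?I"
    by (rule integrable_const_bound[of _ 1]) (auto simp: indicator_def)
  have int2: "integrable P (\<lambda>\<omega>. J \<omega> * ?I \<omega>)"
    by (rule jump_integrable_Ioc[OF J b])
  have I: "(LINT \<omega>|P. ?I \<omega>) = surv a - surv b"
  proof -
    have "(LINT \<omega>|P. ?I \<omega>) = (LINT \<omega>|P. indicator ({\<omega> \<in> space P. ennreal a < \<gamma> \<omega>} - {\<omega> \<in> space P. ennreal b < \<gamma> \<omega>}) \<omega>)"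
      by (intro Bochner_Integration.integral_cong) (auto simp: indicator_def)
    also have "\<dots> = prob ({\<omega> \<in> space P. ennreal a < \<gamma> \<omega>} - {\<omega> \<in> space P. ennreal b < \<gamma> \<omega>})"
      by (simp add: Int_absorb2)
    also have "\<dots> = surv a - surv b"
      unfolding surv_def
    proof (rule finite_measure_Diff)
      show "{\<omega> \<in> space P. ennreal b < \<gamma> \<omega>} \<subseteq> {\<omega> \<in> space P. ennreal a < \<gamma> \<omega>}"
        using le_less_trans[OF ennreal_leI[OF ab(2)]] by blast
    qed measurable
    finally show ?thesis .
  qed
  have J: "(LINT \<omega>|P. J \<omega> * ?I \<omega>) = jump_mean J b - jump_mean J a"
  proof -
    have "jump_mean J b - jump_mean J a = (LINT \<omega>|P. J \<omega> * indicator {\<omega>. 0 < \<gamma> \<omega> \<and> \<gamma> \<omega> \<le> ennreal b} \<omega>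
          - J \<omega> * indicator {\<omega>. 0 < \<gamma> \<omega> \<and> \<gamma> \<omega> \<le> ennreal a} \<omega>)"
      unfolding jump_mean_def
      using jump_integrable_Ioc[OF J a, of 0] jump_integrable_Ioc[OF J b, of 0]
      by (intro Bochner_Integration.integral_diff[symmetric]) auto
    also have "\<dots> = (LINT \<omega>|P. J \<omega> * ?I \<omega>)"
      using ennreal_leI[OF ab(2)] le_less_trans[OF zero_le, of "ennreal a"]
      by (intro Bochner_Integration.integral_cong refl, simp add: indicator_def)
        (meson leD le_less_linear order_trans)
    finally show ?thesis by simp
  qed
  have eq: "(\<lambda>\<omega>. (F b - J \<omega>) / surv a * ?I \<omega>) = (\<lambda>\<omega>. (F b * ?I \<omega> - J \<omega> * ?I \<omega>) / surv a)"
    by (auto simp: fun_eq_iff left_diff_distrib diff_divide_distrib)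
  show "integrable P (\<lambda>\<omega>. (F b - J \<omega>) / surv a * ?I \<omega>)"
    unfolding eq using int1 int2 by auto
  have "(LINT \<omega>|P. (F b * ?I \<omega> - J \<omega> * ?I \<omega>) / surv a) = (F b * (surv a - surv b) - (jump_mean J b - jump_mean J a)) / surv a"
    using int1 int2 I J by simp
  also have "\<dots> = F b - F a"
    using mass_balanceD(2)[OF F a] mass_balanceD(2)[OF F b] pos by (simp add: field_simps)
  finally show "F b - F a = (LINT \<omega>|P. (F b - J \<omega>) / surv a * ?I \<omega>)"
    unfolding eq by simp
qed

text \<open>
  Sum the increments over equidistant partitions of \<open>(0, t]\<close> and refine. For \<open>\<gamma> = x\<close> only the cell
  \<open>(u, v]\<close> that contains \<open>x\<close> contributes, with the value \<open>(F(v) - J) / P(\<gamma> > u)\<close>. As \<open>v\<close> decreases to \<open>x\<close>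
  and \<open>u < x\<close> increases to \<open>x\<close>, this converges to \<open>(F(x) - J) / P(\<gamma> \<ge> x)\<close>: the numerator by right-continuity
  of \<open>F\<close>, the denominator being a left limit.
\<close>

lemma mass_balance_integral_equation:
  assumes F: "mass_balance F J" and t: "0 < t" "ennreal t < t\<^sub>G"
  shows "F t - F 0 = (LINT \<omega>|P. (F (enn2real (\<gamma> \<omega>)) - J \<omega>) / surv_left (enn2real (\<gamma> \<omega>)) *
             indicator {\<omega>. 0 < \<gamma> \<omega> \<and> \<gamma> \<omega> \<le> ennreal t} \<omega>)"
    (is "_ = (LINT \<omega>|P. ?f \<omega>)")
proof -
  note J = mass_balanceD(1)[OF F]
  note [measurable] = jump_integrableD(1)[OF J]
  have tT: "t \<in> \<T>" using before_tG_in_times[of t] t by simp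
  have tpos: "0 < surv t" using surv_pos_iff[of t] t by simp
  define \<delta> where "\<delta> n = t / real (Suc n)" for n :: nat
  have \<delta>: "0 < \<delta> n" "real (Suc n) * \<delta> n = t" for n using t by (simp_all add: \<delta>_def)
  have \<delta>_lim: "\<delta> \<longlonglongrightarrow> 0"
    unfolding \<delta>_def using LIMSEQ_Suc[OF lim_const_over_n[of t]] by simp
  define S where "S n \<omega> = (\<Sum>i<Suc n. (F (real (Suc i) * \<delta> n) - J \<omega>) / surv (real i * \<delta> n) *
      indicator {\<omega>. ennreal (real i * \<delta> n) < \<gamma> \<omega> \<and> \<gamma> \<omega> \<le> ennreal (real (Suc i) * \<delta> n)} \<omega>)" for n \<omega>
  have grid_le: "real i * \<delta> n \<le> t" if "i \<le> Suc n" for i n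
  proof -
    have "real i * \<delta> n \<le> real (Suc n) * \<delta> n"
      using that \<delta>(1)[of n] by (intro mult_right_mono) auto
    then show ?thesis by (simp only: \<delta>(2))
  qed
  have grid_less_tG: "ennreal (real i * \<delta> n) < t\<^sub>G" if "i \<le> Suc n" for i n
    using grid_le[OF that] t by (meson ennreal_leI le_less_trans)
  have S_int: "F t - F 0 = (LINT \<omega>|P. S n \<omega>)" for n
  proof -
    have "F t - F 0 = (\<Sum>i<Suc n. F (real (Suc i) * \<delta> n) - F (real i * \<delta> n))"
      using \<delta>(2)[of n] by (subst sum_lessThan_telescope[of "\<lambda>i. F (real i * \<delta> n)"]) simp
    also have "\<dots> = (LINT \<omega>|P. S n \<omega>)"
      unfolding S_def using \<delta>(1)[of n]
      by (subst Bochner_Integration.integral_sum)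
        (intro sum.cong refl mass_balance_increment[OF F] grid_less_tG mult_right_mono; simp del: of_nat_Suc)+
    finally show ?thesis .
  qed
  obtain C where C: "\<And>s. 0 \<le> s \<Longrightarrow> s \<le> t \<Longrightarrow> surv s \<noteq> 0 \<Longrightarrow> \<bar>F s\<bar> \<le> C"
    using mass_balance_bounded[OF F tT] by blast
  \<comment> \<open>\<open>p n x\<close> is the right end point of the cell that contains \<open>x\<close>\<close>
  define p where "p n x = real (Suc (THE i. real i * \<delta> n < x \<and> x \<le> real (Suc i) * \<delta> n)) * \<delta> n" for n x
  have p: "x \<le> p n x" "p n x - \<delta> n < x" "0 \<le> p n x - \<delta> n" "p n x \<le> t"
    "S n \<omega> = (F (p n x) - J \<omega>) / surv (p n x - \<delta> n)"
    if x: "\<gamma> \<omega> = ennreal x" "0 < x" "x \<le> t" for n x \<omega>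
  proof -
    obtain i where i: "real i * \<delta> n < x" "x \<le> real (Suc i) * \<delta> n"
        "\<And>j. real j * \<delta> n < x \<and> x \<le> real (Suc j) * \<delta> n \<longleftrightarrow> j = i"
      using partition_index[OF \<delta>(1)[of n] x(2)] by blast
    have peq: "p n x = real (Suc i) * \<delta> n"
      unfolding p_def by (simp only: i(3)) simp
    then have peq': "p n x - \<delta> n = real i * \<delta> n" by (simp add: algebra_simps)
    have "real i * \<delta> n < real (Suc n) * \<delta> n" using i(1) x(3) \<delta>(2)[of n] by simp
    then have "i < Suc n" using \<delta>(1)[of n] by (simp add: mult_less_cancel_right_pos del: of_nat_Suc)
    then show "p n x \<le> t" using grid_le[of "Suc i" n] peq by simp
    show "x \<le> p n x" "p n x - \<delta> n < x" using i peq peq' by simp_all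
    show "0 \<le> p n x - \<delta> n" unfolding peq' using \<delta>(1)[of n] by simp
    have ind: "ennreal (real j * \<delta> n) < \<gamma> \<omega> \<and> \<gamma> \<omega> \<le> ennreal (real (Suc j) * \<delta> n) \<longleftrightarrow> j = i" for j
      unfolding i(3)[of j, symmetric] x(1) using \<delta>(1)[of n] x(2)
      by (simp add: ennreal_less_iff ennreal_le_iff del: of_nat_Suc)
    have "S n \<omega> = (\<Sum>j<Suc n. if j = i then (F (real (Suc j) * \<delta> n) - J \<omega>) / surv (real j * \<delta> n) else 0)"
      unfolding S_def by (intro sum.cong refl) (simp add: indicator_def ind del: of_nat_Suc)
    also have "\<dots> = (F (real (Suc i) * \<delta> n) - J \<omega>) / surv (real i * \<delta> n)"
      using \<open>i < Suc n\<close> by (subst sum.delta) (auto simp del: of_nat_Suc)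
    finally show "S n \<omega> = (F (p n x) - J \<omega>) / surv (p n x - \<delta> n)"
      unfolding peq'[symmetric] peq[symmetric] .
  qed
  \<comment> \<open>outside \<open>{0 < \<gamma> \<le> t}\<close> no cell is hit\<close>
  have S_out: "S n \<omega> = 0" if "\<not> (0 < \<gamma> \<omega> \<and> \<gamma> \<omega> \<le> ennreal t)" for n \<omega>
    unfolding S_def
  proof (rule sum.neutral, safe)
    fix i assume "i < Suc n"
    then have "ennreal (real (Suc i) * \<delta> n) \<le> ennreal t"
      by (intro ennreal_leI grid_le) simp
    then have "\<not> (ennreal (real i * \<delta> n) < \<gamma> \<omega> \<and> \<gamma> \<omega> \<le> ennreal (real (Suc i) * \<delta> n))"
      using that by (meson le_less_trans order_trans zero_le)
    then show "(F (real (Suc i) * \<delta> n) - J \<omega>) / surv (real i * \<delta> n) *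
        indicator {\<omega>. ennreal (real i * \<delta> n) < \<gamma> \<omega> \<and> \<gamma> \<omega> \<le> ennreal (real (Suc i) * \<delta> n)} \<omega> = 0"
      by (simp del: of_nat_Suc)
  qed
  have inE: "\<exists>x. \<gamma> \<omega> = ennreal x \<and> 0 < x \<and> x \<le> t" if "0 < \<gamma> \<omega> \<and> \<gamma> \<omega> \<le> ennreal t" for \<omega>
    using that t by (cases "\<gamma> \<omega>") (auto simp: top_unique)
  have S_lim: "(\<lambda>n. S n \<omega>) \<longlonglongrightarrow> ?f \<omega>" for \<omega>
  proof (cases "0 < \<gamma> \<omega> \<and> \<gamma> \<omega> \<le> ennreal t")
    case False
    then have "S n \<omega> = 0" for n by (rule S_out)
    then show ?thesis using False by simp
  next
    case True
    then obtain x where x: "\<gamma> \<omega> = ennreal x" "0 < x" "x \<le> t" using inE by blast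
    have xG: "ennreal x < t\<^sub>G" using t(2) ennreal_leI[OF x(3)] by simp
    have xT: "x \<in> \<T>" using before_tG_in_times[of x] x xG by simp
    have lim_q: "(\<lambda>n. p n x - \<delta> n) \<longlonglongrightarrow> x"
    proof (rule tendsto_sandwich[OF _ _ _ tendsto_const])
      show "(\<lambda>n. x - \<delta> n) \<longlonglongrightarrow> x" using tendsto_diff[OF tendsto_const[of x] \<delta>_lim] by simp
    qed (use p[OF x] in \<open>auto intro!: always_eventually less_imp_le\<close>)
    have lim_p: "(\<lambda>n. p n x) \<longlonglongrightarrow> x"
      using tendsto_add[OF lim_q \<delta>_lim] by simp
    have "continuous (at x within {x..}) F"
      unfolding continuous_within at_within_Ici_at_right
      using mass_balance_tendsto_right[OF F _ xG] x by simp
    then have "(\<lambda>n. F (p n x)) \<longlonglongrightarrow> F x"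
      by (rule continuous_within_tendsto_compose) (use p(1)[OF x] lim_p in auto)
    moreover have "(\<lambda>n. surv (p n x - \<delta> n)) \<longlonglongrightarrow> surv_left x"
    proof (rule filterlim_compose[OF surv_tendsto_left[OF x(2)]])
      show "filterlim (\<lambda>n. p n x - \<delta> n) (at_left x) sequentially"
        unfolding filterlim_at using lim_q p(2)[OF x] by (auto intro!: always_eventually simp: less_imp_neq)
    qed
    ultimately have "(\<lambda>n. (F (p n x) - J \<omega>) / surv (p n x - \<delta> n)) \<longlonglongrightarrow> (F x - J \<omega>) / surv_left x"
      using surv_left_pos[OF xT] by (intro tendsto_intros) auto
    then show ?thesis
      unfolding p(5)[OF x, symmetric] using True x by simp
  qed
  have S_bd: "\<bar>S n \<omega>\<bar> \<le> (\<bar>C\<bar> + \<bar>J \<omega> * indicator {\<omega>. \<gamma> \<omega> \<le> ennreal t} \<omega>\<bar>) / surv t" for n \<omega>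
  proof (cases "0 < \<gamma> \<omega> \<and> \<gamma> \<omega> \<le> ennreal t")
    case False
    then have "S n \<omega> = 0" by (rule S_out)
    then show ?thesis using tpos by simp
  next
    case True
    then obtain x where x: "\<gamma> \<omega> = ennreal x" "0 < x" "x \<le> t" using inE by blast
    note px = p[OF x, of n]
    have pos: "surv t \<le> surv (p n x)" "surv t \<le> surv (p n x - \<delta> n)"
      using px \<delta>(1)[of n] by (auto intro!: surv_antimono)
    have "\<bar>F (p n x)\<bar> \<le> C" using px x pos tpos by (intro C) auto
    then have "\<bar>F (p n x) - J \<omega>\<bar> / surv (p n x - \<delta> n) \<le> (\<bar>C\<bar> + \<bar>J \<omega>\<bar>) / surv t"
      using pos tpos by (intro frac_le) auto
    then show ?thesis using True tpos pos(2) by (simp add: px(5))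
  qed
  have S_meas [measurable]: "S n \<in> borel_measurable P" for n
    unfolding S_def[abs_def] by measurable
  have "?f \<in> borel_measurable P"
    by (rule borel_measurable_LIMSEQ_real[OF S_lim S_meas])
  then have "(\<lambda>n. LINT \<omega>|P. S n \<omega>) \<longlonglongrightarrow> (LINT \<omega>|P. ?f \<omega>)"
    using S_lim S_bd jump_integrableD(2)[OF J tT]
    by (intro integral_dominated_convergence[where w="\<lambda>\<omega>. (\<bar>C\<bar> + \<bar>J \<omega> * indicator {\<omega>. \<gamma> \<omega> \<le> ennreal t} \<omega>\<bar>) / surv t"])
      auto
  then show ?thesis
    unfolding S_int[symmetric] by (simp add: LIMSEQ_const_iff)
qed

text \<open>
  The lost atom at \<open>t\<close> carries the deterministic value \<open>H(t)\<close>.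
\<close>

lemma jump_mean_jump_value_left:
  assumes H: "jump_integrable (jump_value H)" and t: "t \<in> \<T>" and "0 < t"
  shows "(LINT \<omega>|P. jump_value H \<omega> * indicator {\<omega>. 0 < \<gamma> \<omega> \<and> \<gamma> \<omega> < ennreal t} \<omega>) =
      jump_mean (jump_value H) t - H t * (surv_left t - surv t)"
proof -
  let ?Y = "\<lambda>\<omega>. jump_value H \<omega> * indicator {\<omega>. 0 < \<gamma> \<omega> \<and> \<gamma> \<omega> \<le> ennreal t} \<omega>"
  note [measurable] = jump_integrableD(1)[OF H]
  have int: "integrable P ?Y" using jump_integrable_Ioc[OF H t, of 0] by simp
  have int2: "integrable P (\<lambda>\<omega>. H t * indicator {\<omega> \<in> space P. \<gamma> \<omega> = ennreal t} \<omega>)"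
  proof (rule integrable_const_bound[of _ "\<bar>H t\<bar>"])
    show "AE \<omega> in P. norm (H t * indicator {\<omega> \<in> space P. \<gamma> \<omega> = ennreal t} \<omega>) \<le> \<bar>H t\<bar>"
      by (simp add: indicator_def)
  qed measurable
  have "(LINT \<omega>|P. jump_value H \<omega> * indicator {\<omega>. 0 < \<gamma> \<omega> \<and> \<gamma> \<omega> < ennreal t} \<omega>) =
      (LINT \<omega>|P. ?Y \<omega> - H t * indicator {\<omega> \<in> space P. \<gamma> \<omega> = ennreal t} \<omega>)"
  proof (intro Bochner_Integration.integral_cong refl)
    fix \<omega> assume "\<omega> \<in> space P"
    moreover have "jump_value H \<omega> = H t" if "\<gamma> \<omega> = ennreal t"
      using jump_value_eq[of \<omega> t H] that t \<open>0 < t\<close> by simp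
    ultimately show "jump_value H \<omega> * indicator {\<omega>. 0 < \<gamma> \<omega> \<and> \<gamma> \<omega> < ennreal t} \<omega> =
        ?Y \<omega> - H t * indicator {\<omega> \<in> space P. \<gamma> \<omega> = ennreal t} \<omega>"
      using \<open>0 < t\<close> by (cases "\<gamma> \<omega>" "ennreal t" rule: linorder_cases) (auto simp: indicator_def)
  qed
  also have "\<dots> = jump_mean (jump_value H) t - H t * prob {\<omega> \<in> space P. \<gamma> \<omega> = ennreal t}"
    unfolding Bochner_Integration.integral_diff[OF int int2]
    by (simp add: jump_mean_def Int_absorb2)
  also have "prob {\<omega> \<in> space P. \<gamma> \<omega> = ennreal t} = surv_left t - surv t"
  proof -
    have "{\<omega> \<in> space P. \<gamma> \<omega> = ennreal t} = {\<omega> \<in> space P. ennreal t \<le> \<gamma> \<omega>} - {\<omega> \<in> space P. ennreal t < \<gamma> \<omega>}"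
      by auto
    moreover have "prob ({\<omega> \<in> space P. ennreal t \<le> \<gamma> \<omega>} - {\<omega> \<in> space P. ennreal t < \<gamma> \<omega>}) =
        surv_left t - surv t"
      unfolding surv_def surv_left_def by (rule finite_measure_Diff) (measurable, auto)
    ultimately show ?thesis by simp
  qed
  finally show ?thesis .
qed

lemma jump_mean_value_tendsto_left:
  assumes "jump_integrable (jump_value H)" "t \<in> \<T>" "0 < t"
  shows "(jump_mean (jump_value H) \<longlongrightarrow>
      jump_mean (jump_value H) t - H t * (surv_left t - surv t)) (at_left t)"
  using jump_mean_tendsto_left[OF assms] unfolding jump_mean_jump_value_left[OF assms] .

section \<open>Condition M as a mass balance\<close>

lemma set_integral_dG_0:
  assumes "H \<in> borel_measurable borel_\<T>" "b \<in> \<T>"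
  shows "(LINT s:{0<..b}|jump_dG P \<gamma>. H s) = jump_mean (jump_value H) b"
  using set_integral_dG[OF assms(1) order_refl assms(2)] by (simp add: jump_mean_def)

text \<open>
  Before \<open>t\<^sub>G\<close> this is a reformulation. In Case B let \<open>s\<close> increase to \<open>t\<^sub>G\<close> in the equation: with the
  prescribed limit of \<open>F\<close>, the term \<open>F(s) P(\<gamma> > s)\<close> tends to \<open>H(t\<^sub>G) P(\<gamma> = t\<^sub>G)\<close>, which is exactly the atom
  that the integral of \<open>H\<close> over \<open>(0, s]\<close> lacks in the limit.
\<close>

lemma condition_M_imp_mass_balance:
  assumes M: "condition_M P \<gamma> F H"
  shows "mass_balance F (jump_value H)"
proof -
  have H: "H \<in> borel_measurable borel_\<T>" "jump_integrable (jump_value H)"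
    and lim: "case_B P \<gamma> \<Longrightarrow> (F \<longlongrightarrow> H (enn2real t\<^sub>G)) (at_left (enn2real t\<^sub>G))"
    using M by (auto simp: condition_M_def L1_loc_iff)
  have eq: "F t * surv t + jump_mean (jump_value H) t = F 0 * surv 0" if "0 \<le> t" "ennreal t < t\<^sub>G" for t
    using M that before_tG_in_times[of t] set_integral_dG_0[OF H(1), of t]
    by (auto simp: condition_M_def one_minus_cdf)
  have "F t * surv t + jump_mean (jump_value H) t = F 0 * surv 0" if t: "t \<in> \<T>" for t
  proof (rule times_cases[OF t])
    assume "ennreal t < t\<^sub>G"
    with eq times_nonneg[OF t] show ?thesis by blast
  next
    assume B: "case_B P \<gamma>" and tG: "t\<^sub>G = ennreal t"
    have t0: "0 \<le> t" using times_nonneg[OF t] .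
    moreover have "0 < t\<^sub>G" using surv_pos_iff[of 0] surv_0_pos by simp
    ultimately have "0 < t" using tG by simp
    have "((\<lambda>s. F s * surv s + jump_mean (jump_value H) s) \<longlongrightarrow> H t * surv_left t + (jump_mean (jump_value H) t - H t * (surv_left t - surv t))) (at_left t)"
      using lim[OF B] tG t0
      by (intro tendsto_add tendsto_mult surv_tendsto_left jump_mean_value_tendsto_left H t \<open>0 < t\<close>) simp
    moreover have "\<forall>\<^sub>F s in at_left t. F s * surv s + jump_mean (jump_value H) s = F 0 * surv 0"
      by (rule eventually_at_leftI[OF _ \<open>0 < t\<close>]) (auto intro!: eq simp: tG ennreal_less_iff)
    ultimately have "((\<lambda>s. F 0 * surv 0) \<longlongrightarrow> H t * surv_left t + (jump_mean (jump_value H) t - H t * (surv_left t - surv t))) (at_left t)"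
      by (rule Lim_transform_eventually)
    then have "F 0 * surv 0 = H t * surv_left t + (jump_mean (jump_value H) t - H t * (surv_left t - surv t))"
      by (simp add: tendsto_const_iff)
    moreover have "surv t = 0" using surv_eq_0[OF t0] tG by simp
    ultimately show ?thesis by (simp add: algebra_simps)
  qed
  with H show ?thesis by (simp add: mass_balance_def)
qed

text \<open>
  The density is \<open>z = (F - H) / P(\<gamma> \<ge> \<cdot>)\<close>. Measurability of \<open>F\<close> comes from solving
  the mass balance for \<open>F\<close>.
\<close>

lemma mass_balance_imp_loc_abs_cont:
  assumes Hm: "H \<in> borel_measurable borel_\<T>" and F: "mass_balance F (jump_value H)"
  shows "loc_abs_cont P \<gamma> F"
proof -
  note H = mass_balanceD(1)[OF F]
  note [measurable] = jump_integrableD(1)[OF H]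
  \<comment> \<open>if \<open>surv s = 0\<close>, which happens in \<open>\<T>\<close> only at \<open>t\<^sub>G\<close>, division by zero makes this \<open>0\<close>\<close>
  define F' where "F' s = (F 0 * surv 0 - jump_mean (jump_value H) s) / surv s" for s
  define z where "z s = (F' s - H s) / surv_left s" for s
  have F'_eq: "F' s = F s" if "s \<in> \<T>" "surv s \<noteq> 0" for s
    using mass_balance_solve[OF F that] by (simp add: F'_def)
  have z_meas [measurable]: "z \<in> borel_measurable borel_\<T>"
  proof -
    note [measurable] = Hm jump_mean_measurable[OF jump_integrableD(1)[OF H]]
    have [measurable]: "F' \<in> borel_measurable borel" unfolding F'_def by measurable
    then show ?thesis
      unfolding z_def[abs_def]
      by (intro borel_measurable_divide borel_measurable_diff Hm)
        (auto intro!: measurable_restrict_space1)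
  qed
  note [measurable] = jump_value_measurable[OF z_meas]
  have z_L1: "z \<in> L1_loc P \<gamma>"
    unfolding L1_loc_iff
    unfolding jump_integrable_def
  proof (intro conjI ballI z_meas jump_value_measurable)
    fix t assume t: "t \<in> \<T>"
    obtain C where C: "\<And>s. 0 \<le> s \<Longrightarrow> s \<le> t \<Longrightarrow> surv s \<noteq> 0 \<Longrightarrow> \<bar>F s\<bar> \<le> C"
      using mass_balance_bounded[OF F t] by blast
    let ?b = "\<lambda>\<omega>. (\<bar>C\<bar> + \<bar>jump_value H \<omega> * indicator {\<omega>. \<gamma> \<omega> \<le> ennreal t} \<omega>\<bar>) / surv_left t"
    have pos: "0 < surv_left t" by (rule surv_left_pos[OF t])
    show "integrable P (\<lambda>\<omega>. jump_value z \<omega> * indicator {\<omega>. \<gamma> \<omega> \<le> ennreal t} \<omega>)"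
    proof (rule Bochner_Integration.integrable_bound[of P ?b])
      show "integrable P ?b" using jump_integrableD(2)[OF H t] by auto
      show "AE \<omega> in P. norm (jump_value z \<omega> * indicator {\<omega>. \<gamma> \<omega> \<le> ennreal t} \<omega>) \<le> norm (?b \<omega>)"
      proof (rule AE_I2)
        fix \<omega>
        show "norm (jump_value z \<omega> * indicator {\<omega>. \<gamma> \<omega> \<le> ennreal t} \<omega>) \<le> norm (?b \<omega>)"
        proof (cases "\<gamma> \<omega> \<le> ennreal t")
          case True
          then obtain s where s: "\<gamma> \<omega> = ennreal s" "0 \<le> s" "s \<le> t"
            using times_nonneg[OF t] by (cases "\<gamma> \<omega>") (auto simp: top_unique)
          have "\<bar>F' s\<bar> \<le> \<bar>C\<bar>"
            using C[of s] s F'_eq[OF times_downward[OF t s(2,3)]] by (cases "surv s = 0") (auto simp: F'_def)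
          then have "\<bar>F' s - H s\<bar> / surv_left s \<le> (\<bar>C\<bar> + \<bar>H s\<bar>) / surv_left t"
            using surv_left_antimono[OF s(3)] pos by (intro frac_le) auto
          moreover have "0 \<le> (\<bar>C\<bar> + \<bar>H s\<bar>) / surv_left t" "0 < surv_left s"
            using pos surv_left_antimono[OF s(3)] by auto
          ultimately show ?thesis
            using True jump_value_eq[OF True t, of z] jump_value_eq[OF True t, of H] s pos
            by (simp add: z_def)
        qed (use pos in simp)
      qed
    qed measurable
  qed
  show ?thesis
    unfolding loc_abs_cont_def
  proof (intro bexI[OF _ z_L1] allI impI)
    fix t assume t: "0 \<le> t" "ennreal t < t\<^sub>G"
    have tT: "t \<in> \<T>" using before_tG_in_times[OF t] .
    have "F t - F 0 = jump_mean (jump_value z) t"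
    proof (cases "t = 0")
      case False
      then have t0: "0 < t" using t by simp
      show ?thesis
        unfolding mass_balance_integral_equation[OF F t0 t(2)] jump_mean_def
      proof (intro Bochner_Integration.integral_cong refl)
        fix \<omega>
        show "(F (enn2real (\<gamma> \<omega>)) - jump_value H \<omega>) / surv_left (enn2real (\<gamma> \<omega>)) *
             indicator {\<omega>. 0 < \<gamma> \<omega> \<and> \<gamma> \<omega> \<le> ennreal t} \<omega> =
           jump_value z \<omega> * indicator {\<omega>. 0 < \<gamma> \<omega> \<and> \<gamma> \<omega> \<le> ennreal t} \<omega>"
        proof (cases "\<gamma> \<omega> \<le> ennreal t")
          case True
          then obtain s where s: "\<gamma> \<omega> = ennreal s" "0 \<le> s" "s \<le> t"
            using t by (cases "\<gamma> \<omega>") (auto simp: top_unique)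
          have "surv s \<noteq> 0"
            using surv_antimono[OF s(3)] surv_pos_iff[OF t(1)] t(2) by linarith
          then have "F' s = F s" using F'_eq times_downward[OF tT s(2,3)] by blast
          then show ?thesis
            using jump_value_eq[OF True tT, of z] jump_value_eq[OF True tT, of H] s
            by (simp add: z_def)
        qed simp
      qed
    qed simp
    then show "F t = F 0 + (LINT s:{0<..t}|jump_dG P \<gamma>. z s)"
      unfolding set_integral_dG_0[OF z_meas tT] by simp
  qed
qed

text \<open>
  Solving the balance for \<open>F(s)\<close> and subtracting the balance at \<open>t\<^sub>G\<close> represents \<open>F(s)\<close> as the mean of
  \<open>H(\<gamma>)\<close> over \<open>{\<gamma> > s}\<close>, an event that shrinks to \<open>{\<gamma> = t\<^sub>G}\<close> as \<open>s\<close> increases to \<open>t\<^sub>G\<close>.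
\<close>

lemma mass_balance_tendsto_left_case_B:
  assumes F: "mass_balance F (jump_value H)" and B: "case_B P \<gamma>"
  shows "(F \<longlongrightarrow> H (enn2real t\<^sub>G)) (at_left (enn2real t\<^sub>G))"
proof -
  note H = mass_balanceD(1)[OF F]
  obtain g where g: "0 < g" "t\<^sub>G = ennreal g" "g \<in> \<T>"
    using B by (rule case_BE)
  have sg: "surv g = 0" using surv_eq_0[of g] g by simp
  have "((\<lambda>s. (F 0 * surv 0 - jump_mean (jump_value H) s) / surv s) \<longlongrightarrow>
      (F 0 * surv 0 - (jump_mean (jump_value H) g - H g * (surv_left g - surv g))) / surv_left g) (at_left g)"
    using surv_left_pos[OF g(3)] by (intro tendsto_intros jump_mean_value_tendsto_left surv_tendsto_left H g) simp
  also have "(F 0 * surv 0 - (jump_mean (jump_value H) g - H g * (surv_left g - surv g))) / surv_left g = H g"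
    using mass_balanceD(2)[OF F g(3)] surv_left_pos[OF g(3)] sg by (simp add: field_simps)
  finally have lim: "((\<lambda>s. (F 0 * surv 0 - jump_mean (jump_value H) s) / surv s) \<longlongrightarrow> H g) (at_left g)" .
  have "\<forall>\<^sub>F s in at_left g. (F 0 * surv 0 - jump_mean (jump_value H) s) / surv s = F s"
  proof (rule eventually_at_leftI[OF _ g(1)])
    fix s assume s: "s \<in> {0<..<g}"
    then have "0 < surv s" using surv_pos_iff[of s] g by (simp add: ennreal_less_iff)
    then show "(F 0 * surv 0 - jump_mean (jump_value H) s) / surv s = F s"
      using mass_balance_solve[OF F times_downward[OF g(3), of s]] s by simp
  qed
  then have "(F \<longlongrightarrow> H g) (at_left g)"
    by (rule Lim_transform_eventually[OF lim])
  then show ?thesis using g by simp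
qed

theorem condition_M_iff_mass_balance:
  "condition_M P \<gamma> F H \<longleftrightarrow> H \<in> borel_measurable borel_\<T> \<and> mass_balance F (jump_value H)"
proof
  assume "H \<in> borel_measurable borel_\<T> \<and> mass_balance F (jump_value H)"
  then have Hm: "H \<in> borel_measurable borel_\<T>" and F: "mass_balance F (jump_value H)" by auto
  have "H \<in> L1_loc P \<gamma>" using Hm mass_balanceD(1)[OF F] by (simp add: L1_loc_iff)
  moreover have "F t * (1 - jump_cdf P \<gamma> t) + (LINT s:{0<..t}|jump_dG P \<gamma>. H s) = F 0 * (1 - jump_cdf P \<gamma> 0)"
    if "0 \<le> t" "ennreal t < t\<^sub>G" for t
    using that mass_balanceD(2)[OF F] before_tG_in_times[OF that] set_integral_dG_0[OF Hm]
    by (simp add: one_minus_cdf)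
  ultimately show "condition_M P \<gamma> F H"
    unfolding condition_M_def
    using mass_balance_imp_loc_abs_cont[OF Hm F] mass_balance_tendsto_left_case_B[OF F] by blast
next
  assume "condition_M P \<gamma> F H"
  then show "H \<in> borel_measurable borel_\<T> \<and> mass_balance F (jump_value H)"
    using condition_M_imp_mass_balance by (auto simp: condition_M_def L1_loc_iff)
qed

abbreviation "\<F> \<equiv> single_jump_filtration P \<gamma>"

definition jump_process :: "(real \<Rightarrow> real) \<Rightarrow> ('a \<Rightarrow> real) \<Rightarrow> real \<Rightarrow> 'a \<Rightarrow> real" where
  "jump_process F J t \<omega> = F t * indicator {\<omega>. ennreal t < \<gamma> \<omega>} \<omega> + J \<omega> * indicator {\<omega>. \<gamma> \<omega> \<le> ennreal t} \<omega>"

lemma jump_process_before: "ennreal t < \<gamma> \<omega> \<Longrightarrow> jump_process F J t \<omega> = F t"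
  and jump_process_after: "\<gamma> \<omega> \<le> ennreal t \<Longrightarrow> jump_process F J t \<omega> = J \<omega>"
  by (auto simp: jump_process_def)

text \<open>
  If \<open>\<gamma> = \<infinity>\<close> has positive probability, then \<open>\<T>\<close> is the whole half-line; otherwise this outcome is negligible.
\<close>

lemma AE_until_jump_in_times: "AE \<omega> in P. \<forall>t\<ge>0. ennreal t \<le> \<gamma> \<omega> \<longrightarrow> t \<in> \<T>"
proof -
  have inf: "AE \<omega> in P. \<gamma> \<omega> = \<infinity> \<longrightarrow> (\<forall>t\<ge>0. t \<in> \<T>)"
  proof (cases "prob {\<omega> \<in> space P. \<gamma> \<omega> = \<infinity>} = 0")
    case True
    then have "AE \<omega> in P. \<gamma> \<omega> \<noteq> \<infinity>"
      by (subst AE_iff_measurable[OF _ refl]) (auto simp: emeasure_eq_measure)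
    then show ?thesis by eventually_elim simp
  next
    case False
    have "prob {\<omega> \<in> space P. \<gamma> \<omega> = \<infinity>} \<le> prob {\<omega> \<in> space P. ennreal t \<le> \<gamma> \<omega>}" for t
      by (intro finite_measure_mono) auto
    then have "t \<in> \<T>" if "0 \<le> t" for t
      using False that measure_nonneg[of P "{\<omega> \<in> space P. \<gamma> \<omega> = \<infinity>}"]
      unfolding jump_times_def by (metis (mono_tags, lifting) less_le_trans mem_Collect_eq order_le_imp_less_or_eq)
    then show ?thesis by simp
  qed
  from AE_jump_in_times inf show ?thesis
  proof eventually_elim
    case (elim \<omega>)
    show ?case
    proof (intro allI impI)
      fix t :: real assume t: "0 \<le> t" "ennreal t \<le> \<gamma> \<omega>"
      show "t \<in> \<T>"
      proof (cases "\<gamma> \<omega>")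
        case (real r)
        then have "t \<le> r" using t by simp
        then show ?thesis using elim(1) real times_downward[of r t] t by simp
      qed (use elim t in simp)
    qed
  qed
qed

section \<open>The martingale property of balanced jump processes\<close>

lemma jump_process_integrable:
  assumes J: "jump_integrable J" and t: "t \<in> \<T>"
  shows "integrable P (jump_process F J t)"
proof -
  have "integrable P (\<lambda>\<omega>. F t * indicator {\<omega>. ennreal t < \<gamma> \<omega>} \<omega>)"
  proof (rule integrable_const_bound[of _ "\<bar>F t\<bar>"])
    show "AE \<omega> in P. norm (F t * indicator {\<omega>. ennreal t < \<gamma> \<omega>} \<omega>) \<le> \<bar>F t\<bar>"
      by (simp add: indicator_def)
  qed measurable
  then show ?thesis
    unfolding jump_process_def[abs_def]
    by (intro Bochner_Integration.integrable_add jump_integrableD(2)[OF J t])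
qed

lemma expectation_jump_process:
  assumes J: "jump_integrable J" and t: "t \<in> \<T>"
  shows "(LINT \<omega>|P. jump_process F J t \<omega>) =
    F t * surv t + jump_mean J t + (LINT \<omega>|P. J \<omega> * indicator {\<omega>. \<gamma> \<omega> \<le> 0} \<omega>)"
proof -
  let ?I = "indicator {\<omega> \<in> space P. ennreal t < \<gamma> \<omega>} :: 'a \<Rightarrow> real"
  have i1: "integrable P (\<lambda>\<omega>. F t * ?I \<omega>)"
  proof (rule integrable_const_bound[of _ "\<bar>F t\<bar>"])
    show "AE \<omega> in P. norm (F t * ?I \<omega>) \<le> \<bar>F t\<bar>"
      by (simp add: indicator_def)
  qed measurable
  have i2: "integrable P (\<lambda>\<omega>. J \<omega> * indicator {\<omega>. 0 < \<gamma> \<omega> \<and> \<gamma> \<omega> \<le> ennreal t} \<omega>)"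
    using jump_integrable_Ioc[OF J t, of 0] by simp
  have i3: "integrable P (\<lambda>\<omega>. J \<omega> * indicator {\<omega>. \<gamma> \<omega> \<le> 0} \<omega>)"
    using jump_integrableD(2)[OF J zero_in_times] by simp
  have "(LINT \<omega>|P. jump_process F J t \<omega>) =
     (LINT \<omega>|P. F t * ?I \<omega> + J \<omega> * indicator {\<omega>. 0 < \<gamma> \<omega> \<and> \<gamma> \<omega> \<le> ennreal t} \<omega> + J \<omega> * indicator {\<omega>. \<gamma> \<omega> \<le> 0} \<omega>)"
    by (intro Bochner_Integration.integral_cong refl)
      (auto simp: jump_process_def indicator_def not_le not_less)
  also have "\<dots> = (LINT \<omega>|P. F t * ?I \<omega>) + jump_mean J t + (LINT \<omega>|P. J \<omega> * indicator {\<omega>. \<gamma> \<omega> \<le> 0} \<omega>)"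
    unfolding jump_mean_def
    by (simp only: Bochner_Integration.integral_add i1 i2 i3 Bochner_Integration.integrable_add)
  also have "(LINT \<omega>|P. F t * ?I \<omega>) = F t * surv t"
    by (simp add: surv_def Int_absorb2)
  finally show ?thesis .
qed

lemma sets_\<F>: "A \<in> sets (\<F> t) \<longleftrightarrow> A \<in> sets P \<and>
    (A \<inter> {\<omega> \<in> space P. t < \<gamma> \<omega>} = {} \<or> {\<omega> \<in> space P. t < \<gamma> \<omega>} \<subseteq> A)"
  unfolding sets_single_jump_filtration by blast

lemma sets_\<F>_mono: "s \<le> t \<Longrightarrow> sets (\<F> s) \<subseteq> sets (\<F> t)"
  using filtration.sets_F_mono[OF filtration_single_jump_filtration] .

lemma measurable_\<F>_mono:
  assumes "f \<in> borel_measurable (\<F> s)" "s \<le> t"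
  shows "f \<in> borel_measurable (\<F> t)"
  using assms sets_\<F>_mono[OF assms(2)] by (auto simp: measurable_def)

lemma measurable_\<F>_P: "f \<in> borel_measurable (\<F> s) \<Longrightarrow> f \<in> borel_measurable P"
  using measurable_from_subalg[OF subalgebra_single_jump_filtration] .

text \<open>
  An event of time \<open>s\<close> either misses the atom \<open>{s < \<gamma>}\<close>, and then the process does not change on it
  between \<open>s\<close> and \<open>t\<close>, or it contains the atom, and then it carries the whole change of the process.
  The expectation of this change vanishes by the mass balance.
\<close>

lemma jump_process_martingale_property:
  assumes F: "mass_balance F J" and st: "0 \<le> s" "s \<le> t" "t \<in> \<T>"
    and A: "A \<in> sets (\<F> (ennreal s))"
  shows "(LINT \<omega>:A|P. jump_process F J t \<omega>) = (LINT \<omega>:A|P. jump_process F J s \<omega>)"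
proof -
  note J = mass_balanceD(1)[OF F]
  have s: "s \<in> \<T>" using times_downward[OF st(3,1,2)] .
  note it = jump_process_integrable[OF J st(3), of F] and is' = jump_process_integrable[OF J s, of F]
  have same: "jump_process F J t \<omega> = jump_process F J s \<omega>" if "\<gamma> \<omega> \<le> ennreal s" for \<omega>
    using that order_trans[OF that ennreal_leI[OF st(2)]] by (simp add: jump_process_after)
  have AP: "A \<in> sets P" using A by (simp add: sets_\<F>)
  have split: "A \<inter> {\<omega> \<in> space P. ennreal s < \<gamma> \<omega>} = {} \<or> {\<omega> \<in> space P. ennreal s < \<gamma> \<omega>} \<subseteq> A"
    using A by (simp add: sets_\<F>)
  then show ?thesis
  proof
    assume "A \<inter> {\<omega> \<in> space P. ennreal s < \<gamma> \<omega>} = {}"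
    then show ?thesis
      by (intro set_lebesgue_integral_cong[OF AP]) (use sets.sets_into_space[OF AP] same in force)
  next
    assume sub: "{\<omega> \<in> space P. ennreal s < \<gamma> \<omega>} \<subseteq> A"
    have "(LINT \<omega>:A|P. jump_process F J t \<omega>) - (LINT \<omega>:A|P. jump_process F J s \<omega>) =
        (LINT \<omega>|P. indicator A \<omega> *\<^sub>R jump_process F J t \<omega> - indicator A \<omega> *\<^sub>R jump_process F J s \<omega>)"
      unfolding set_lebesgue_integral_def
      by (rule Bochner_Integration.integral_diff[symmetric]; rule integrable_mult_indicator[OF AP]; fact)
    also have "\<dots> = (LINT \<omega>|P. jump_process F J t \<omega> - jump_process F J s \<omega>)"
      by (intro Bochner_Integration.integral_cong refl) (use sub same in \<open>force simp: indicator_def not_le\<close>)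
    also have "\<dots> = 0"
      unfolding Bochner_Integration.integral_diff[OF it is'] expectation_jump_process[OF J st(3)]
        expectation_jump_process[OF J s]
      using mass_balanceD(2)[OF F s] mass_balanceD(2)[OF F st(3)] by simp
    finally show ?thesis by simp
  qed
qed

section \<open>From the mass balance to a local martingale\<close>

text \<open>
  Solving the balance for \<open>F\<close>, the denominator \<open>P(\<gamma> > s)\<close> tends to \<open>P(\<gamma> \<ge> t)\<close>, which is positive on \<open>\<T>\<close>,
  even at \<open>t\<^sub>G\<close> in Case B.
\<close>

lemma mass_balance_left_limit:
  assumes F: "mass_balance F J" and t: "t \<in> \<T>" "0 < t"
  shows "\<exists>l. (F \<longlongrightarrow> l) (at_left t)"
proof -
  note J = mass_balanceD(1)[OF F]
  let ?l = "(F 0 * surv 0 - (LINT \<omega>|P. J \<omega> * indicator {\<omega>. 0 < \<gamma> \<omega> \<and> \<gamma> \<omega> < ennreal t} \<omega>)) / surv_left t"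
  have lim: "((\<lambda>s. (F 0 * surv 0 - jump_mean J s) / surv s) \<longlongrightarrow> ?l) (at_left t)"
    using surv_left_pos[OF t(1)] by (intro tendsto_intros jump_mean_tendsto_left surv_tendsto_left J t) simp
  have "\<forall>\<^sub>F s in at_left t. (F 0 * surv 0 - jump_mean J s) / surv s = F s"
  proof (rule eventually_at_leftI[OF _ t(2)])
    fix s assume s: "s \<in> {0<..<t}"
    then have "0 < surv s"
      using surv_left_le_surv[of s t] surv_left_pos[OF t(1)] by simp
    then show "(F 0 * surv 0 - jump_mean J s) / surv s = F s"
      using mass_balance_solve[OF F times_downward[OF t(1), of s]] s by simp
  qed
  then have "(F \<longlongrightarrow> ?l) (at_left t)"
    by (rule Lim_transform_eventually[OF lim])
  then show ?thesis by (rule exI)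
qed

lemma jump_process_left_limit:
  assumes F: "mass_balance F J" and times: "\<forall>t\<ge>0. ennreal t \<le> \<gamma> \<omega> \<longrightarrow> t \<in> \<T>" and t: "0 < t"
  shows "\<exists>l. ((\<lambda>s. jump_process F J s \<omega>) \<longlongrightarrow> l) (at_left t)"
proof (cases "ennreal t \<le> \<gamma> \<omega>")
  case True
  then have "t \<in> \<T>" using times t by simp
  then obtain l where l: "(F \<longlongrightarrow> l) (at_left t)"
    using mass_balance_left_limit[OF F _ t] by blast
  have "\<forall>\<^sub>F s in at_left t. F s = jump_process F J s \<omega>"
  proof (rule eventually_at_leftI[OF _ t])
    fix s assume "s \<in> {0<..<t}"
    then have "ennreal s < ennreal t" by (simp add: ennreal_less_iff)
    then show "F s = jump_process F J s \<omega>"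
      using True by (intro jump_process_before[symmetric]) (rule less_le_trans)
  qed
  then have "((\<lambda>s. jump_process F J s \<omega>) \<longlongrightarrow> l) (at_left t)"
    by (rule Lim_transform_eventually[OF l])
  then show ?thesis by (rule exI)
next
  case False
  then obtain r where r: "\<gamma> \<omega> = ennreal r" "r < t" "0 \<le> r"
    by (cases "\<gamma> \<omega>") (auto simp: not_le ennreal_less_iff)
  have "\<forall>\<^sub>F s in at_left t. jump_process F J s \<omega> = J \<omega>"
  proof (rule eventually_at_leftI[OF _ r(2)])
    fix s assume "s \<in> {r<..<t}"
    then show "jump_process F J s \<omega> = J \<omega>"
      using r by (intro jump_process_after) (auto intro: ennreal_leI)
  qed
  then show ?thesis by (intro exI[of _ "J \<omega>"] tendsto_eventually)
qed

text \<open>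
  The elements of \<open>\<T>\<close> may be bounded, so constant times cannot localize. Switching the stopping off
  once the jump has occurred repairs this, and does not change the stopped process, which is
  constant after the jump.
\<close>

definition frozen_time :: "real \<Rightarrow> 'a \<Rightarrow> ennreal" where
  "frozen_time \<tau> \<omega> = (if \<gamma> \<omega> \<le> ennreal \<tau> then \<infinity> else ennreal \<tau>)"

lemma stopping_time_frozen_time: "stopping_time \<F> (frozen_time \<tau>)"
proof
  fix t :: ennreal
  let ?A = "{\<omega> \<in> space P. frozen_time \<tau> \<omega> \<le> t}"
  have "?A \<in> sets P"
    unfolding frozen_time_def by measurable
  moreover have "?A \<inter> {\<omega> \<in> space P. t < \<gamma> \<omega>} = {} \<or> {\<omega> \<in> space P. t < \<gamma> \<omega>} \<subseteq> ?A"
  proof (cases "ennreal \<tau> \<le> t")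
    case True
    then have "{\<omega> \<in> space P. t < \<gamma> \<omega>} \<subseteq> ?A"
      by (auto simp: frozen_time_def dest: order.strict_trans1)
    then show ?thesis ..
  next
    case False
    then have "t < \<infinity>" by (auto simp: not_le intro: less_trans)
    then have empty: "?A = {}" using False by (auto simp: frozen_time_def top_unique)
    show ?thesis unfolding empty by (intro disjI1 Int_empty_left)
  qed
  ultimately show "Measurable.pred (\<F> t) (\<lambda>\<omega>. frozen_time \<tau> \<omega> \<le> t)"
    by (simp add: pred_def sets_\<F>)
qed

lemma stopped_frozen:
  assumes "0 \<le> t" "0 \<le> \<tau>"
  shows "stopped_process M (frozen_time \<tau>) t \<omega> =
    (if \<gamma> \<omega> \<le> ennreal \<tau> then M t \<omega> else M (min t \<tau>) \<omega>)"
proof -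
  have "min (ennreal t) (ennreal \<tau>) = ennreal (min t \<tau>)"
    using ennreal_leI[of t \<tau>] ennreal_leI[of \<tau> t] by (cases "t \<le> \<tau>") (simp_all add: min_absorb1 min_absorb2)
  then show ?thesis
    using assms by (simp add: stopped_process_def frozen_time_def)
qed

lemma stopped_frozen_adapted:
  assumes M: "adapted_process \<F> M" and "0 \<le> \<tau>"
  shows "adapted_process \<F> (stopped_process M (frozen_time \<tau>))"
  unfolding adapted_process_def
proof (intro allI impI)
  fix t :: real assume t: "0 \<le> t"
  have Mt: "M s \<in> borel_measurable (\<F> (ennreal t))" if "0 \<le> s" "s \<le> t" for s
    using M that measurable_\<F>_mono[of "M s" "ennreal s" "ennreal t"]
    by (auto simp: adapted_process_def ennreal_leI)
  show "stopped_process M (frozen_time \<tau>) t \<in> borel_measurable (\<F> (ennreal t))"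
  proof (cases "t < \<tau>")
    case True
    then have "stopped_process M (frozen_time \<tau>) t = M t"
      using t by (auto simp: stopped_frozen fun_eq_iff)
    then show ?thesis using Mt[of t] t by simp
  next
    case False
    have "{\<omega> \<in> space P. \<gamma> \<omega> \<le> ennreal \<tau>} \<in> sets (\<F> (ennreal t))"
    proof -
      have "\<not> (\<gamma> \<omega> \<le> ennreal \<tau> \<and> ennreal t < \<gamma> \<omega>)" for \<omega>
        using ennreal_leI[of \<tau> t] False by (meson leD not_le order.strict_trans1 less_imp_le)
      then show ?thesis unfolding sets_\<F> by auto
    qed
    then have "(\<lambda>\<omega>. if \<gamma> \<omega> \<le> ennreal \<tau> then M t \<omega> else M (min t \<tau>) \<omega>) \<in> borel_measurable (\<F> (ennreal t))"
      using False t \<open>0 \<le> \<tau>\<close> by (intro measurable_If Mt) auto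
    also have "(\<lambda>\<omega>. if \<gamma> \<omega> \<le> ennreal \<tau> then M t \<omega> else M (min t \<tau>) \<omega>) = stopped_process M (frozen_time \<tau>) t"
      using t \<open>0 \<le> \<tau>\<close> by (simp add: stopped_frozen fun_eq_iff)
    finally show ?thesis .
  qed
qed

lemma stopped_frozen_jump_process:
  assumes M: "indistinguishable P M (jump_process F J)" and "0 \<le> \<tau>"
  shows "AE \<omega> in P. \<forall>t\<ge>0. stopped_process M (frozen_time \<tau>) t \<omega> = jump_process F J (min t \<tau>) \<omega>"
  using M unfolding indistinguishable_def
proof eventually_elim
  case (elim \<omega>)
  show ?case
  proof (intro allI impI)
    fix t :: real assume t: "0 \<le> t"
    have "jump_process F J t \<omega> = jump_process F J \<tau> \<omega>" if "\<gamma> \<omega> \<le> ennreal \<tau>" "\<tau> \<le> t"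
      using that order_trans[OF that(1) ennreal_leI[OF that(2)]] by (simp add: jump_process_after)
    then show "stopped_process M (frozen_time \<tau>) t \<omega> = jump_process F J (min t \<tau>) \<omega>"
      using elim t \<open>0 \<le> \<tau>\<close> by (auto simp: stopped_frozen min_def)
  qed
qed

lemma stopped_frozen_martingale:
  assumes F: "mass_balance F J" and M: "adapted_process \<F> M" "indistinguishable P M (jump_process F J)"
    and \<tau>: "\<tau> \<in> \<T>"
  shows "martingale P \<F> (stopped_process M (frozen_time \<tau>))"
proof -
  note J = mass_balanceD(1)[OF F]
  have \<tau>0: "0 \<le> \<tau>" using times_nonneg[OF \<tau>] .
  let ?X = "stopped_process M (frozen_time \<tau>)"
  have adX: "adapted_process \<F> ?X" by (rule stopped_frozen_adapted[OF M(1) \<tau>0])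
  have X_meas: "?X t \<in> borel_measurable (\<F> (ennreal t))" if "0 \<le> t" for t
    using adX that by (simp add: adapted_process_def)
  have X_measP: "?X t \<in> borel_measurable P" if "0 \<le> t" for t
    using measurable_\<F>_P[OF X_meas[OF that]] .
  have X_eq: "AE \<omega> in P. ?X t \<omega> = jump_process F J (min t \<tau>) \<omega>" if "0 \<le> t" for t
    using stopped_frozen_jump_process[OF M(2) \<tau>0] by eventually_elim (use that in simp)
  have minT: "min t \<tau> \<in> \<T>" if "0 \<le> t" for t
    using times_downward[OF \<tau>, of "min t \<tau>"] that \<tau>0 by simp
  have N_int: "integrable P (jump_process F J (min t \<tau>))" if "0 \<le> t" for t
    by (rule jump_process_integrable[OF J minT[OF that]])
  have X_int: "integrable P (?X t)" if "0 \<le> t" for t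
    using N_int[OF that] X_eq[OF that]
    by (subst integrable_cong_AE[OF X_measP[OF that] borel_measurable_integrable[OF N_int[OF that]]]) auto
  show ?thesis
    unfolding martingale_def
  proof (intro conjI allI impI adX X_int)
    fix s t :: real assume st: "0 \<le> s" "s \<le> t"
    then have t: "0 \<le> t" by simp
    interpret S: finite_measure_subalgebra P "\<F> (ennreal s)"
      by unfold_locales (rule subalgebra_single_jump_filtration)
    show "AE \<omega> in P. real_cond_exp P (\<F> (ennreal s)) (?X t) \<omega> = ?X s \<omega>"
    proof (rule S.real_cond_exp_charact[OF _ X_int[OF t] X_int[OF st(1)] X_meas[OF st(1)]])
      fix A assume A: "A \<in> sets (\<F> (ennreal s))"
      then have AP: "A \<in> sets P" by (simp add: sets_\<F>)
      have eq: "(LINT \<omega>:A|P. ?X u \<omega>) = (LINT \<omega>:A|P. jump_process F J (min u \<tau>) \<omega>)" if "0 \<le> u" for u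
      proof (rule set_lebesgue_integral_cong_AE[OF AP X_measP[OF that]])
        show "jump_process F J (min u \<tau>) \<in> borel_measurable P"
          using N_int[OF that] by (rule borel_measurable_integrable)
        show "AE \<omega>\<in>A in P. ?X u \<omega> = jump_process F J (min u \<tau>) \<omega>"
          using X_eq[OF that] by eventually_elim simp
      qed
      have "(LINT \<omega>:A|P. jump_process F J (min t \<tau>) \<omega>) = (LINT \<omega>:A|P. jump_process F J (min s \<tau>) \<omega>)"
      proof (cases "s \<le> \<tau>")
        case True
        then show ?thesis
          using st A \<tau>0 jump_process_martingale_property[OF F _ _ minT[OF t], of s A] by simp
      next
        case False
        then show ?thesis using st by simp
      qed
      then show "(LINT \<omega>:A|P. ?X t \<omega>) = (LINT \<omega>:A|P. ?X s \<omega>)"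
        using eq[OF t] eq[OF st(1)] by simp
    qed
  qed
qed

text \<open>
  At a time \<open>t\<close> with \<open>P(\<gamma> > t) = 0\<close> the value of \<open>F\<close> is uncontrolled, but also invisible almost surely;
  hence the bound holds only almost surely, for each time separately.
\<close>

lemma jump_process_dominated:
  assumes F: "mass_balance F J" and \<tau>: "\<tau> \<in> \<T>"
  obtains Y where "integrable P Y" "\<And>t. 0 \<le> t \<Longrightarrow> t \<le> \<tau> \<Longrightarrow> AE \<omega> in P. \<bar>jump_process F J t \<omega>\<bar> \<le> Y \<omega>"
proof -
  note J = mass_balanceD(1)[OF F]
  obtain C where C: "\<And>s. 0 \<le> s \<Longrightarrow> s \<le> \<tau> \<Longrightarrow> surv s \<noteq> 0 \<Longrightarrow> \<bar>F s\<bar> \<le> C"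
    using mass_balance_bounded[OF F \<tau>] by blast
  define Y where "Y \<omega> = \<bar>C\<bar> + \<bar>J \<omega> * indicator {\<omega>. \<gamma> \<omega> \<le> ennreal \<tau>} \<omega>\<bar>" for \<omega>
  show ?thesis
  proof (rule that)
    show "integrable P Y"
      unfolding Y_def using jump_integrableD(2)[OF J \<tau>] by (intro Bochner_Integration.integrable_add integrable_abs) auto
    fix t assume t: "0 \<le> t" "t \<le> \<tau>"
    have "AE \<omega> in P. ennreal t < \<gamma> \<omega> \<longrightarrow> \<bar>F t\<bar> \<le> C"
    proof (cases "surv t = 0")
      case True
      then have "AE \<omega> in P. \<not> ennreal t < \<gamma> \<omega>"
        unfolding surv_def by (subst AE_iff_measurable[OF _ refl]) (auto simp: emeasure_eq_measure)
      then show ?thesis by eventually_elim simp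
    qed (use C[of t] t in simp)
    then show "AE \<omega> in P. \<bar>jump_process F J t \<omega>\<bar> \<le> Y \<omega>"
    proof eventually_elim
      case (elim \<omega>)
      show ?case
      proof (cases "ennreal t < \<gamma> \<omega>")
        case True
        then show ?thesis using elim by (simp add: jump_process_before Y_def)
      next
        case False
        then have "\<gamma> \<omega> \<le> ennreal \<tau>" using ennreal_leI[OF t(2)] by (meson not_le order_trans)
        with False show ?thesis by (simp add: jump_process_after Y_def)
      qed
    qed
  qed
qed

lemma stopped_frozen_uniformly_integrable:
  assumes F: "mass_balance F J" and M: "indistinguishable P M (jump_process F J)" and \<tau>: "\<tau> \<in> \<T>"
  shows "uniformly_integrable P (stopped_process M (frozen_time \<tau>))"
proof -
  have \<tau>0: "0 \<le> \<tau>" using times_nonneg[OF \<tau>] .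
  obtain Y where Y: "integrable P Y" "\<And>t. 0 \<le> t \<Longrightarrow> t \<le> \<tau> \<Longrightarrow> AE \<omega> in P. \<bar>jump_process F J t \<omega>\<bar> \<le> Y \<omega>"
    using jump_process_dominated[OF F \<tau>] by blast
  show ?thesis
  proof (rule uniformly_integrable_dominated[OF Y(1)])
    fix t :: real assume t: "0 \<le> t"
    then have "AE \<omega> in P. \<bar>jump_process F J (min t \<tau>) \<omega>\<bar> \<le> Y \<omega>" using \<tau>0 by (intro Y(2)) auto
    with stopped_frozen_jump_process[OF M \<tau>0]
    show "AE \<omega> in P. \<bar>stopped_process M (frozen_time \<tau>) t \<omega>\<bar> \<le> Y \<omega>"
      by eventually_elim (use t in simp)
  qed
qed

text \<open>
  A path with a jump in \<open>\<T>\<close> is eventually never stopped; on a path without jump the times in \<open>\<T>\<close>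
  are unbounded.
\<close>

lemma frozen_times_localize:
  assumes \<tau>: "incseq \<tau>" "range \<tau> \<subseteq> \<T>" "\<And>t. t \<in> \<T> \<Longrightarrow> \<exists>n. t \<le> \<tau> n"
    and times: "\<forall>t\<ge>0. ennreal t \<le> \<gamma> \<omega> \<longrightarrow> t \<in> \<T>"
  shows "incseq (\<lambda>n. frozen_time (\<tau> n) \<omega>)" and "(\<lambda>n. frozen_time (\<tau> n) \<omega>) \<longlonglongrightarrow> \<infinity>"
proof -
  show inc: "incseq (\<lambda>n. frozen_time (\<tau> n) \<omega>)"
  proof (rule incseq_SucI)
    fix n
    have "ennreal (\<tau> n) \<le> ennreal (\<tau> (Suc n))" using \<tau>(1) by (intro ennreal_leI) (simp add: incseq_SucD)
    then show "frozen_time (\<tau> n) \<omega> \<le> frozen_time (\<tau> (Suc n)) \<omega>"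
      by (auto simp: frozen_time_def dest: order_trans)
  qed
  have "(SUP n. frozen_time (\<tau> n) \<omega>) = \<infinity>"
  proof (rule ccontr)
    assume "(SUP n. frozen_time (\<tau> n) \<omega>) \<noteq> \<infinity>"
    then obtain b where b: "(SUP n. frozen_time (\<tau> n) \<omega>) = ennreal b" "0 \<le> b"
      by (cases "SUP n. frozen_time (\<tau> n) \<omega>") auto
    have le: "frozen_time (\<tau> n) \<omega> \<le> ennreal b" for n
      unfolding b(1)[symmetric] by (rule SUP_upper) simp
    have \<gamma>: "ennreal (\<tau> n) < \<gamma> \<omega>" "\<tau> n \<le> b" for n
      using le[of n] b(2) by (auto simp: frozen_time_def top_unique not_le split: if_splits)
    show False
    proof (cases "\<gamma> \<omega>")
      case (real r)
      then have "r \<in> \<T>" using times by simp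
      then obtain n where "r \<le> \<tau> n" using \<tau>(3) by blast
      then show False using \<gamma>(1)[of n] real ennreal_leI[of r "\<tau> n"] by (simp add: leD)
    next
      case top
      then have "b + 1 \<in> \<T>" using times b(2) by simp
      then obtain n where "b + 1 \<le> \<tau> n" using \<tau>(3) by blast
      then show False using \<gamma>(2)[of n] by simp
    qed
  qed
  then show "(\<lambda>n. frozen_time (\<tau> n) \<omega>) \<longlonglongrightarrow> \<infinity>"
    using LIMSEQ_SUP[OF inc] by argo
qed

text \<open>
  Stopped at \<open>frozen_time \<tau>\<close>, the process is almost surely the balanced process stopped at the constant
  \<open>\<tau> \<in> \<T>\<close>, to which the martingale property and the domination on \<open>[0, \<tau>]\<close> apply.
\<close>

theorem mass_balance_imp_local_martingale:
  assumes F: "mass_balance F J" and M: "adapted_process \<F> M" "indistinguishable P M (jump_process F J)"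
    and rc: "\<forall>\<omega>\<in>space P. right_continuous_path (\<lambda>t. M t \<omega>)"
  shows "local_martingale P \<F> M"
proof -
  obtain \<tau> :: "nat \<Rightarrow> real" where \<tau>: "incseq \<tau>" "range \<tau> \<subseteq> \<T>" "\<And>t. t \<in> \<T> \<Longrightarrow> \<exists>n. t \<le> \<tau> n"
    using times_cofinal by blast
  then have \<tau>T: "\<tau> n \<in> \<T>" for n by auto
  have "AE \<omega> in P. cadlag_path (\<lambda>t. M t \<omega>)"
    using AE_space AE_until_jump_in_times M(2)[unfolded indistinguishable_def]
  proof eventually_elim
    case (elim \<omega>)
    have "\<exists>l. ((\<lambda>s. M s \<omega>) \<longlongrightarrow> l) (at_left t)" if t: "0 < t" for t
    proof -
      obtain l where l: "((\<lambda>s. jump_process F J s \<omega>) \<longlongrightarrow> l) (at_left t)"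
        using jump_process_left_limit[OF F elim(2) t] by blast
      have "\<forall>\<^sub>F s in at_left t. jump_process F J s \<omega> = M s \<omega>"
        by (rule eventually_at_leftI[OF _ t]) (use elim(3) in simp)
      then have "((\<lambda>s. M s \<omega>) \<longlongrightarrow> l) (at_left t)"
        by (rule Lim_transform_eventually[OF l])
      then show ?thesis by (rule exI)
    qed
    then show ?case using rc elim(1) by (simp add: cadlag_path_def)
  qed
  moreover have "AE \<omega> in P. incseq (\<lambda>n. frozen_time (\<tau> n) \<omega>) \<and> (\<lambda>n. frozen_time (\<tau> n) \<omega>) \<longlonglongrightarrow> \<infinity>"
    using AE_until_jump_in_times by eventually_elim (use frozen_times_localize[OF \<tau>] in blast)
  ultimately show ?thesis
    unfolding local_martingale_def
    using M(1) stopping_time_frozen_time stopped_frozen_martingale[OF F M \<tau>T]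
      stopped_frozen_uniformly_integrable[OF F M(2) \<tau>T]
    by (intro conjI exI[of _ "\<lambda>n. frozen_time (\<tau> n)"]) auto
qed

section \<open>From a local martingale to the mass balance\<close>

text \<open>
  While \<open>t < \<gamma>\<close>, the decision to stop by time \<open>t\<close> can only be taken for all such outcomes at once.
  The constant is the first \<open>t\<close> at which it has been taken.
\<close>

lemma stopping_time_before_jump:
  assumes T: "stopping_time \<F> T"
  obtains r where "\<And>\<omega>. \<omega> \<in> space P \<Longrightarrow> min (T \<omega>) (\<gamma> \<omega>) = min r (\<gamma> \<omega>)"
proof
  define S where "S = {t. {\<omega> \<in> space P. t < \<gamma> \<omega>} \<subseteq> {\<omega> \<in> space P. T \<omega> \<le> t}}"
  \<comment> \<open>the alternative in the definition of the filtration, applied to \<open>{T \<le> t}\<close>\<close>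
  have alt: "t \<in> S" if "\<omega> \<in> space P" "T \<omega> \<le> t" "t < \<gamma> \<omega>" for t \<omega>
  proof -
    have "{\<omega> \<in> space P. T \<omega> \<le> t} \<in> sets (\<F> t)"
      using stopping_timeD[OF T, of t] by (simp add: pred_def)
    then show ?thesis
      using that unfolding sets_\<F> S_def by blast
  qed
  have S: "T \<omega> \<le> t" if "t \<in> S" "\<omega> \<in> space P" "t < \<gamma> \<omega>" for t \<omega>
    using that unfolding S_def by blast
  fix \<omega> assume \<omega>: "\<omega> \<in> space P"
  show "min (T \<omega>) (\<gamma> \<omega>) = min (Inf S) (\<gamma> \<omega>)"
  proof (cases "T \<omega> < \<gamma> \<omega>")
    case True
    have "Inf S \<le> T \<omega>" using alt[OF \<omega> order_refl True] by (rule Inf_lower)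
    moreover have "T \<omega> \<le> Inf S"
    proof (rule Inf_greatest)
      fix t assume "t \<in> S"
      then show "T \<omega> \<le> t" using S[OF _ \<omega>, of t] True by (cases "t < \<gamma> \<omega>") auto
    qed
    ultimately have "T \<omega> = Inf S" by simp
    then show ?thesis by simp
  next
    case False
    have "\<gamma> \<omega> \<le> Inf S"
    proof (rule Inf_greatest)
      fix t assume "t \<in> S"
      then show "\<gamma> \<omega> \<le> t" using S[OF _ \<omega>, of t] False by (cases "t < \<gamma> \<omega>") auto
    qed
    then show ?thesis using False by (simp add: min_absorb2)
  qed
qed

text \<open>
  An event of the form \<open>{M\<^sub>t = x}\<close> that meets the atom \<open>{t < \<gamma>}\<close> contains it.
\<close>

lemma adapted_constant_before_jump:
  assumes M: "adapted_process \<F> M"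
  obtains c where "\<And>t \<omega>. 0 \<le> t \<Longrightarrow> \<omega> \<in> space P \<Longrightarrow> ennreal t < \<gamma> \<omega> \<Longrightarrow> M t \<omega> = c t"
proof
  define c where "c t = M t (SOME \<omega>. \<omega> \<in> space P \<and> ennreal t < \<gamma> \<omega>)" for t
  fix t \<omega> assume t: "0 \<le> t" and \<omega>: "\<omega> \<in> space P" "ennreal t < \<gamma> \<omega>"
  define \<eta> where "\<eta> = (SOME \<omega>. \<omega> \<in> space P \<and> ennreal t < \<gamma> \<omega>)"
  have \<eta>: "\<eta> \<in> space P \<and> ennreal t < \<gamma> \<eta>"
    unfolding \<eta>_def by (rule someI[of _ \<omega>]) (use \<omega> in simp)
  have "M t \<in> borel_measurable (\<F> (ennreal t))"
    using M t by (simp add: adapted_process_def)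
  then have "M t -` {M t \<omega>} \<inter> space (\<F> (ennreal t)) \<in> sets (\<F> (ennreal t))"
    by (rule measurable_sets) simp
  then have "\<eta> \<in> M t -` {M t \<omega>}"
    using \<omega> \<eta> unfolding sets_\<F> space_single_jump_filtration by blast
  then show "M t \<omega> = c t" by (simp add: c_def \<eta>_def)
qed

text \<open>
  Every measurable subset of \<open>{\<gamma> \<le> s}\<close> is an event of time \<open>s\<close>. Hence the variable \<open>X\<^sub>t\<close>, restricted to this
  event, is its own conditional expectation, which is \<open>X\<^sub>s\<close> by the martingale property.
\<close>

lemma martingale_constant_after_jump:
  assumes X: "martingale P \<F> X" and st: "0 \<le> s" "s \<le> t"
  shows "AE \<omega> in P. \<gamma> \<omega> \<le> ennreal s \<longrightarrow> X t \<omega> = X s \<omega>"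
proof -
  interpret S: finite_measure_subalgebra P "\<F> (ennreal s)"
    by unfold_locales (rule subalgebra_single_jump_filtration)
  have t: "0 \<le> t" using st by simp
  have int: "integrable P (X t)" and cond: "AE \<omega> in P. real_cond_exp P (\<F> (ennreal s)) (X t) \<omega> = X s \<omega>"
    using X st t by (auto simp: martingale_def)
  note [measurable] = borel_measurable_integrable[OF int]
  define A where "A = {\<omega> \<in> space P. \<gamma> \<omega> \<le> ennreal s}"
  have AP: "A \<in> sets P" unfolding A_def by measurable
  have sub: "B \<in> sets (\<F> (ennreal s))" if "B \<in> sets P" "B \<subseteq> A" for B
    using that unfolding sets_\<F> A_def by (auto simp: not_le)
  have A: "A \<in> sets (\<F> (ennreal s))" using sub[OF AP] by simp
  let ?Y = "\<lambda>\<omega>. indicator A \<omega> * X t \<omega>"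
  have int': "integrable P ?Y" using integrable_mult_indicator[OF AP int] by simp
  have Y_meas: "?Y \<in> borel_measurable (\<F> (ennreal s))"
  proof (rule measurableI)
    fix B :: "real set" assume B: "B \<in> sets borel"
    have XB: "A \<inter> (X t -` B \<inter> space P) \<in> sets (\<F> (ennreal s))"
      using AP B by (intro sub) auto
    have "?Y -` B \<inter> space (\<F> (ennreal s)) =
        A \<inter> (X t -` B \<inter> space P) \<union> (if 0 \<in> B then space P - A else {})"
    proof (rule set_eqI)
      show "\<omega> \<in> ?Y -` B \<inter> space (\<F> (ennreal s)) \<longleftrightarrow>
          \<omega> \<in> A \<inter> (X t -` B \<inter> space P) \<union> (if 0 \<in> B then space P - A else {})" for \<omega>
        by (cases "\<omega> \<in> A") auto
    qed
    also have "\<dots> \<in> sets (\<F> (ennreal s))"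
      using XB sets.compl_sets[OF A] by auto
    finally show "?Y -` B \<inter> space (\<F> (ennreal s)) \<in> sets (\<F> (ennreal s))" .
  qed simp
  have 1: "AE \<omega> in P. real_cond_exp P (\<F> (ennreal s)) ?Y \<omega> = ?Y \<omega>"
    by (rule S.real_cond_exp_F_meas[OF int' Y_meas])
  have 2: "AE \<omega> in P. real_cond_exp P (\<F> (ennreal s)) ?Y \<omega> = indicator A \<omega> * real_cond_exp P (\<F> (ennreal s)) (X t) \<omega>"
    using A int' by (intro S.real_cond_exp_mult) auto
  from 1 2 cond AE_space show ?thesis
    by eventually_elim (auto simp: A_def)
qed

text \<open>
  Let the stopping times tend to infinity to pass from the stopped processes to \<open>M\<close>, first at rational
  times to have a single null set, then at all times by right-continuity.
\<close>

lemma local_martingale_constant_after_jump: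
  assumes M: "local_martingale P \<F> M"
    and rc: "\<forall>\<omega>\<in>space P. right_continuous_path (\<lambda>t. M t \<omega>)"
  shows "AE \<omega> in P. \<forall>s\<ge>0. \<forall>t\<ge>s. \<gamma> \<omega> \<le> ennreal s \<longrightarrow> M t \<omega> = M s \<omega>"
proof -
  obtain T :: "nat \<Rightarrow> 'a \<Rightarrow> ennreal" where
      T: "AE \<omega> in P. incseq (\<lambda>n. T n \<omega>) \<and> (\<lambda>n. T n \<omega>) \<longlonglongrightarrow> \<infinity>"
      and mart: "\<And>n. martingale P \<F> (stopped_process M (T n))"
    using M unfolding local_martingale_def by blast
  have "AE \<omega> in P. \<forall>n. \<forall>q\<in>\<rat>. \<forall>p\<in>\<rat>. 0 \<le> p \<longrightarrow> p \<le> q \<longrightarrow> \<gamma> \<omega> \<le> ennreal p \<longrightarrow>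
      stopped_process M (T n) q \<omega> = stopped_process M (T n) p \<omega>"
    unfolding AE_all_countable AE_ball_countable[OF countable_rat]
  proof (intro allI ballI)
    fix n and p q :: real
    show "AE \<omega> in P. 0 \<le> p \<longrightarrow> p \<le> q \<longrightarrow> \<gamma> \<omega> \<le> ennreal p \<longrightarrow>
        stopped_process M (T n) q \<omega> = stopped_process M (T n) p \<omega>"
      using martingale_constant_after_jump[OF mart[of n], of p q]
      by (cases "0 \<le> p \<and> p \<le> q") auto
  qed
  with T AE_space show ?thesis
  proof eventually_elim
    case (elim \<omega>)
    have rat: "M q \<omega> = M p \<omega>" if pq: "p \<in> \<rat>" "q \<in> \<rat>" "0 \<le> p" "p \<le> q" "\<gamma> \<omega> \<le> ennreal p" for p q
    proof -
      have "\<forall>\<^sub>F n in sequentially. ennreal q < T n \<omega>"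
        using elim(1) by (auto dest: order_tendstoD(1)[of _ _ _ "ennreal q"])
      then obtain n where n: "ennreal q < T n \<omega>"
        by (auto dest: eventually_happens)
      moreover have "ennreal p < T n \<omega>" using ennreal_leI[OF pq(4)] n by simp
      ultimately have "stopped_process M (T n) q \<omega> = M q \<omega>" "stopped_process M (T n) p \<omega> = M p \<omega>"
        using pq by (simp_all add: stopped_process_def min_absorb1 less_imp_le)
      then show ?thesis using elim(3) pq by metis
    qed
    \<comment> \<open>a value that the path takes at all rationals to the right of \<open>s\<close> is also taken at \<open>s\<close>\<close>
    have appr: "\<exists>q\<in>\<rat>. s < q \<and> (\<forall>c. (\<forall>q'\<in>\<rat>. s < q' \<longrightarrow> M q' \<omega> = c) \<longrightarrow> M s \<omega> = c)" if s: "0 \<le> s" for s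
    proof -
      have "\<exists>q\<in>\<rat>. s < q \<and> q < s + 1 / real (Suc n)" for n
        using Rats_dense_in_real[of s "s + 1 / real (Suc n)"] by auto
      then obtain q where q: "\<And>n. q n \<in> \<rat>" "\<And>n. s < q n" "\<And>n. q n < s + 1 / real (Suc n)"
        by metis
      have "q \<longlonglongrightarrow> s"
      proof (rule tendsto_sandwich[OF _ _ tendsto_const])
        show "(\<lambda>n. s + 1 / real (Suc n)) \<longlonglongrightarrow> s"
          using tendsto_add[OF tendsto_const[of s] LIMSEQ_Suc[OF lim_const_over_n[of 1]]] by simp
      qed (use q in \<open>auto intro!: always_eventually less_imp_le simp del: of_nat_Suc\<close>)
      moreover have "continuous (at s within {s..}) (\<lambda>t. M t \<omega>)"
        using rc elim(2) s by (simp add: right_continuous_path_def continuous_within at_within_Ici_at_right)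
      ultimately have lim: "(\<lambda>n. M (q n) \<omega>) \<longlonglongrightarrow> M s \<omega>"
        by (intro continuous_within_tendsto_compose[of s "{s..}" "\<lambda>t. M t \<omega>" q sequentially])
          (use q(2) in \<open>auto intro!: always_eventually less_imp_le\<close>)
      show ?thesis
      proof (intro bexI[OF _ q(1)[of 0]] conjI q(2) allI impI)
        fix c assume "\<forall>q'\<in>\<rat>. s < q' \<longrightarrow> M q' \<omega> = c"
        then have "(\<lambda>n. M (q n) \<omega>) = (\<lambda>n. c)" using q by auto
        with lim show "M s \<omega> = c" by (simp add: LIMSEQ_const_iff)
      qed
    qed
    show ?case
    proof (intro allI impI)
      fix s t :: real assume st: "0 \<le> s" "s \<le> t" "\<gamma> \<omega> \<le> ennreal s"
      have *: "M q \<omega> = M q' \<omega>" if "q \<in> \<rat>" "q' \<in> \<rat>" "s < q" "s < q'" for q q'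
      proof -
        have "\<gamma> \<omega> \<le> ennreal q" "\<gamma> \<omega> \<le> ennreal q'"
          using st(3) ennreal_leI[of s q] ennreal_leI[of s q'] that by (auto intro: order_trans)
        then show ?thesis
          using rat[of q q'] rat[of q' q] that st(1) by (cases "q \<le> q'") auto
      qed
      obtain q where q: "q \<in> \<rat>" "s < q" using appr[OF st(1)] by blast
      have "M u \<omega> = M q \<omega>" if "s \<le> u" for u
      proof -
        have "\<forall>q'\<in>\<rat>. u < q' \<longrightarrow> M q' \<omega> = M q \<omega>" using * q that by (meson le_less_trans)
        then show ?thesis using appr[of u] that st(1) by auto
      qed
      from this[of s] this[of t] st(2) show "M t \<omega> = M s \<omega>" by simp
    qed
  qed
qed

lemma times_le_tG: "t \<in> \<T> \<Longrightarrow> ennreal t \<le> t\<^sub>G"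
  by (erule times_cases) auto

lemma AE_before_jump_less_tG: "AE \<omega> in P. \<forall>t\<ge>0. ennreal t < \<gamma> \<omega> \<longrightarrow> ennreal t < t\<^sub>G"
  using AE_until_jump_in_times
proof eventually_elim
  case (elim \<omega>)
  show ?case
  proof (intro allI impI)
    fix t :: real assume t: "0 \<le> t" "ennreal t < \<gamma> \<omega>"
    obtain u where u: "ennreal t < u" "u < \<gamma> \<omega>" using dense[OF t(2)] by blast
    then obtain t' where t': "u = ennreal t'" "0 \<le> t'" by (cases u) auto
    then have "t' \<in> \<T>" using elim u by simp
    then show "ennreal t < t\<^sub>G" using times_le_tG[of t'] u t' by simp
  qed
qed

text \<open>
  \<open>J\<close> is the value at which the path freezes. Taking it as the limit along the integers makes it
  measurable. The values of \<open>F\<close> from \<open>t\<^sub>G\<close> on are invisible almost surely; the choice \<open>0\<close> is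
  right-continuous.
\<close>

lemma local_martingale_jump_process:
  assumes M: "local_martingale P \<F> M"
    and rc: "\<forall>\<omega>\<in>space P. right_continuous_path (\<lambda>t. M t \<omega>)"
  obtains F J where "indistinguishable P M (jump_process F J)" "J \<in> borel_measurable P"
    "\<And>\<omega>. \<gamma> \<omega> = \<infinity> \<Longrightarrow> J \<omega> = 0" "\<And>t. t\<^sub>G \<le> ennreal t \<Longrightarrow> F t = 0"
proof -
  have ad: "adapted_process \<F> M" using M by (simp add: local_martingale_def)
  obtain c where c: "\<And>t \<omega>. 0 \<le> t \<Longrightarrow> \<omega> \<in> space P \<Longrightarrow> ennreal t < \<gamma> \<omega> \<Longrightarrow> M t \<omega> = c t"
    using adapted_constant_before_jump[OF ad] by blast
  define F where "F t = (if ennreal t < t\<^sub>G then c t else 0)" for t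
  define J where "J \<omega> = (if \<gamma> \<omega> < \<infinity> then lim (\<lambda>k. M (real k) \<omega>) else 0)" for \<omega>
  have [measurable]: "M (real k) \<in> borel_measurable P" for k :: nat
    using ad measurable_\<F>_P[of "M (real k)" "ennreal (real k)"] by (simp add: adapted_process_def)
  show ?thesis
  proof (rule that)
    show "J \<in> borel_measurable P"
      unfolding J_def[abs_def] by (intro measurable_If borel_measurable_lim_metric) measurable
    show "J \<omega> = 0" if "\<gamma> \<omega> = \<infinity>" for \<omega> using that by (simp add: J_def)
    show "F t = 0" if "t\<^sub>G \<le> ennreal t" for t using that by (simp add: F_def)
    show "indistinguishable P M (jump_process F J)"
      unfolding indistinguishable_def
      using local_martingale_constant_after_jump[OF M rc] AE_before_jump_less_tG AE_space
    proof eventually_elim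
      case (elim \<omega>)
      show ?case
      proof (intro allI impI)
        fix t :: real assume t: "0 \<le> t"
        show "M t \<omega> = jump_process F J t \<omega>"
        proof (cases "ennreal t < \<gamma> \<omega>")
          case True
          then show ?thesis using elim t c by (simp add: jump_process_before F_def)
        next
          case False
          then have le: "\<gamma> \<omega> \<le> ennreal t" by simp
          have "\<forall>\<^sub>F k in sequentially. M (real k) \<omega> = M t \<omega>"
            using eventually_ge_at_top[of "nat \<lceil>t\<rceil>"]
          proof eventually_elim
            case (elim k)
            then have "t \<le> real k" by linarith
            then show ?case using \<open>\<forall>s\<ge>0. \<forall>t\<ge>s. \<gamma> \<omega> \<le> ennreal s \<longrightarrow> M t \<omega> = M s \<omega>\<close> t le by blast
          qed
          then have "lim (\<lambda>k. M (real k) \<omega>) = M t \<omega>"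
            by (intro limI tendsto_eventually)
          moreover have "\<gamma> \<omega> < \<infinity>" using le by (auto intro: le_less_trans)
          ultimately show ?thesis using le by (simp add: jump_process_after J_def)
        qed
      qed
    qed
  qed
qed

text \<open>
  On \<open>{\<gamma> \<ge> t}\<close>, which has positive probability, some outcome has \<open>T\<^sub>n > t\<close> for large \<open>n\<close>. As \<open>T\<^sub>n\<close> is
  deterministic before the jump, the bound \<open>t\<close> carries over from this outcome to the constant \<open>r\<close>.
\<close>

lemma localizing_sequence_reaches:
  assumes T: "\<And>n. stopping_time \<F> (T n)" "AE \<omega> in P. (\<lambda>n. T n \<omega>) \<longlonglongrightarrow> (\<infinity>::ennreal)"
    and t: "t \<in> \<T>"
  obtains n r where "ennreal t \<le> r" "\<And>\<omega>. \<omega> \<in> space P \<Longrightarrow> min (T n \<omega>) (\<gamma> \<omega>) = min r (\<gamma> \<omega>)"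
proof -
  have "\<exists>\<omega>\<in>space P. ennreal t \<le> \<gamma> \<omega> \<and> (\<lambda>n. T n \<omega>) \<longlonglongrightarrow> \<infinity>"
  proof (rule ccontr)
    assume none: "\<not> (\<exists>\<omega>\<in>space P. ennreal t \<le> \<gamma> \<omega> \<and> (\<lambda>n. T n \<omega>) \<longlonglongrightarrow> \<infinity>)"
    have "AE \<omega> in P. \<not> ennreal t \<le> \<gamma> \<omega>"
      using T(2) AE_space by eventually_elim (use none in blast)
    then have "prob {\<omega> \<in> space P. ennreal t \<le> \<gamma> \<omega>} = 0"
      by (subst (asm) AE_iff_measurable[OF _ refl]) (auto simp: emeasure_eq_measure)
    then show False using t by (simp add: jump_times_def)
  qed
  then obtain \<omega> where \<omega>: "\<omega> \<in> space P" "ennreal t \<le> \<gamma> \<omega>" "(\<lambda>n. T n \<omega>) \<longlonglongrightarrow> \<infinity>" by blast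
  have "\<forall>\<^sub>F n in sequentially. ennreal t < T n \<omega>"
    using order_tendstoD(1)[OF \<omega>(3), of "ennreal t"] by simp
  then obtain n where n: "ennreal t < T n \<omega>" by (auto dest: eventually_happens)
  obtain r where r: "\<And>\<omega>. \<omega> \<in> space P \<Longrightarrow> min (T n \<omega>) (\<gamma> \<omega>) = min r (\<gamma> \<omega>)"
    using stopping_time_before_jump[OF T(1)] by blast
  have "ennreal t \<le> min (T n \<omega>) (\<gamma> \<omega>)" using n \<omega>(2) by simp
  then have "ennreal t \<le> r" unfolding r[OF \<omega>(1)] by simp
  then show ?thesis using r that by blast
qed

text \<open>
  For \<open>t \<in> \<T>\<close> choose a localizing time with constant \<open>r \<ge> t\<close>. Up to \<open>t\<close> the stopped process is \<open>M\<close>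
  itself: if it is stopped at all before \<open>t\<close>, then not before the jump, from which on \<open>M\<close> is frozen.
  So \<open>M\<close> is integrable with constant expectation on \<open>[0, t]\<close>.
\<close>

theorem local_martingale_imp_mass_balance:
  assumes M: "local_martingale P \<F> M" and N: "indistinguishable P M (jump_process F J)"
    and [measurable]: "J \<in> borel_measurable P"
  shows "mass_balance F J"
proof -
  obtain T :: "nat \<Rightarrow> 'a \<Rightarrow> ennreal" where
      T: "\<And>n. stopping_time \<F> (T n)" "AE \<omega> in P. incseq (\<lambda>n. T n \<omega>) \<and> (\<lambda>n. T n \<omega>) \<longlonglongrightarrow> \<infinity>"
      and mart: "\<And>n. martingale P \<F> (stopped_process M (T n))"
    using M unfolding local_martingale_def by blast
  have T': "AE \<omega> in P. (\<lambda>n. T n \<omega>) \<longlonglongrightarrow> \<infinity>" using T(2) by eventually_elim simp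
  have N_meas [measurable]: "jump_process F J t \<in> borel_measurable P" for t
    unfolding jump_process_def[abs_def] by measurable
  have *: "integrable P (jump_process F J t) \<and>
     (LINT \<omega>|P. jump_process F J t \<omega>) = (LINT \<omega>|P. jump_process F J 0 \<omega>)" if t: "t \<in> \<T>" for t
  proof -
    have t0: "0 \<le> t" using times_nonneg[OF t] .
    obtain n r where r: "ennreal t \<le> r" "\<And>\<omega>. \<omega> \<in> space P \<Longrightarrow> min (T n \<omega>) (\<gamma> \<omega>) = min r (\<gamma> \<omega>)"
      using localizing_sequence_reaches[OF T(1) T' t] by blast
    let ?X = "stopped_process M (T n)"
    have X_int: "integrable P (?X s)" if "0 \<le> s" for s
      using mart[of n] that by (simp add: martingale_def)
    have X_eq: "AE \<omega> in P. ?X s \<omega> = jump_process F J s \<omega>" if s: "0 \<le> s" "s \<le> t" for s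
      using N[unfolded indistinguishable_def] AE_space
    proof eventually_elim
      case (elim \<omega>)
      show ?case
      proof (cases "ennreal s \<le> T n \<omega>")
        case True
        then show ?thesis using elim s by (simp add: stopped_process_def min_absorb1)
      next
        case False
        then obtain u where u: "T n \<omega> = ennreal u" "0 \<le> u" "u < s"
          by (cases "T n \<omega>") (auto simp: not_le ennreal_less_iff)
        have "ennreal u < r"
          using r(1) u s by (meson ennreal_lessI le_less_trans less_le_trans not_le)
        then have "\<gamma> \<omega> \<le> ennreal u"
          using r(2)[OF elim(2)] u(1) by (auto simp: min_def split: if_splits)
        moreover have "\<gamma> \<omega> \<le> ennreal s"
          using calculation ennreal_leI[of u s] u(3) by (meson less_imp_le order_trans)
        moreover have "?X s \<omega> = M u \<omega>"
          using False u by (simp add: stopped_process_def min_absorb2)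
        ultimately show ?thesis using elim(1) u(2) by (simp add: jump_process_after)
      qed
    qed
    have N_int: "integrable P (jump_process F J s)" and N_exp: "(LINT \<omega>|P. jump_process F J s \<omega>) = (LINT \<omega>|P. ?X s \<omega>)"
      if s: "0 \<le> s" "s \<le> t" for s
    proof -
      note [measurable] = borel_measurable_integrable[OF X_int[OF s(1)]]
      show "integrable P (jump_process F J s)"
        using X_int[OF s(1)] X_eq[OF s] by (subst integrable_cong_AE[of _ _ "?X s"]) auto
      show "(LINT \<omega>|P. jump_process F J s \<omega>) = (LINT \<omega>|P. ?X s \<omega>)"
        using X_eq[OF s] by (intro integral_cong_AE) auto
    qed
    interpret S: finite_measure_subalgebra P "\<F> (ennreal 0)"
      by unfold_locales (rule subalgebra_single_jump_filtration)
    have "(LINT \<omega>|P. ?X t \<omega>) = (LINT \<omega>|P. real_cond_exp P (\<F> (ennreal 0)) (?X t) \<omega>)"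
      by (rule S.real_cond_exp_int(2)[OF X_int[OF t0], symmetric])
    also have "\<dots> = (LINT \<omega>|P. ?X 0 \<omega>)"
    proof (rule integral_cong_AE)
      show "AE \<omega> in P. real_cond_exp P (\<F> (ennreal 0)) (?X t) \<omega> = ?X 0 \<omega>"
        using mart[of n] t0 unfolding martingale_def by blast
    qed (use X_int[of 0] in auto)
    finally show ?thesis using N_int[of t] N_exp[of t] N_exp[of 0] t0 by simp
  qed
  have J: "jump_integrable J"
    unfolding jump_integrable_def
  proof (intro conjI ballI)
    fix t assume t: "t \<in> \<T>"
    have "integrable P (\<lambda>\<omega>. indicator {\<omega> \<in> space P. \<gamma> \<omega> \<le> ennreal t} \<omega> *\<^sub>R jump_process F J t \<omega>)"
      using * t by (intro integrable_mult_indicator) auto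
    also have "?this \<longleftrightarrow> integrable P (\<lambda>\<omega>. J \<omega> * indicator {\<omega>. \<gamma> \<omega> \<le> ennreal t} \<omega>)"
      by (intro Bochner_Integration.integrable_cong refl) (auto simp: indicator_def jump_process_after)
    finally show "integrable P (\<lambda>\<omega>. J \<omega> * indicator {\<omega>. \<gamma> \<omega> \<le> ennreal t} \<omega>)" .
  qed fact
  show ?thesis
    unfolding mass_balance_def
  proof (intro conjI ballI J)
    fix t assume t: "t \<in> \<T>"
    show "F t * surv t + jump_mean J t = F 0 * surv 0"
      using *[OF t] expectation_jump_process[OF J t, of F] expectation_jump_process[OF J zero_in_times, of F] by simp
  qed
qed

section \<open>Splitting the jump into its conditional mean and a centred part\<close>

lemma sets_generated_sigma:
  "sets (generated_sigma P \<gamma>) = {\<gamma> -` B \<inter> space P |B. B \<in> sets borel}"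
  unfolding generated_sigma_def by (rule sets_vimage_algebra2) simp

lemma space_generated_sigma [simp]: "space (generated_sigma P \<gamma>) = space P"
  by (simp add: generated_sigma_def)

lemma subalgebra_generated_sigma: "subalgebra P (generated_sigma P \<gamma>)"
  unfolding subalgebra_def by (auto simp: sets_generated_sigma)

sublocale jump_algebra: finite_measure_subalgebra P "generated_sigma P \<gamma>"
  by unfold_locales (rule subalgebra_generated_sigma)

lemma jump_time_measurable_generated [measurable]: "\<gamma> \<in> borel_measurable (generated_sigma P \<gamma>)"
  unfolding generated_sigma_def by (rule measurable_vimage_algebra1) simp

text \<open>
  The factorization is applied to the conditional expectations of the positive and the negative part,
  whose difference the generalized conditional expectation is.
\<close>

lemma cond_exp_factor:
  fixes Y :: "'a \<Rightarrow> real"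
  obtains h :: "ennreal \<Rightarrow> real" where "h \<in> borel_measurable borel"
    "\<And>\<omega>. \<omega> \<in> space P \<Longrightarrow> real_cond_exp P (generated_sigma P \<gamma>) Y \<omega> = h (\<gamma> \<omega>)"
proof -
  have "\<exists>h\<in>borel_measurable borel. \<forall>\<omega>\<in>space P. nn_cond_exp P (generated_sigma P \<gamma>) Z \<omega> = h (\<gamma> \<omega>)" for Z
    using borel_measurable_nn_cond_exp[of P "generated_sigma P \<gamma>" Z]
    unfolding generated_sigma_def by (intro measurable_vimage_algebra_factor) auto
  then obtain h1 h2 where [measurable]: "h1 \<in> borel_measurable borel" "h2 \<in> borel_measurable borel"
    and "\<And>\<omega>. \<omega> \<in> space P \<Longrightarrow> nn_cond_exp P (generated_sigma P \<gamma>) (\<lambda>\<omega>. ennreal (Y \<omega>)) \<omega> = h1 (\<gamma> \<omega>)"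
    "\<And>\<omega>. \<omega> \<in> space P \<Longrightarrow> nn_cond_exp P (generated_sigma P \<gamma>) (\<lambda>\<omega>. ennreal (- Y \<omega>)) \<omega> = h2 (\<gamma> \<omega>)"
    by metis
  then show ?thesis
    by (intro that[of "\<lambda>x. enn2real (h1 x) - enn2real (h2 x)"]) (auto simp: real_cond_exp_def)
qed

text \<open>
  A variable \<open>L\<close> that need not be integrable is tested on countably many events of the \<open>\<sigma>\<close>-algebra on each
  of which it is integrable; conditioning commutes with the restriction to such an event.
\<close>

lemma cond_exp_zeroI:
  assumes [measurable]: "L \<in> borel_measurable P"
    and A: "\<And>n::nat. A n \<in> sets (generated_sigma P \<gamma>)" "AE \<omega> in P. \<exists>n. \<omega> \<in> A n"
    and int: "\<And>n. integrable P (\<lambda>\<omega>. indicator (A n) \<omega> * L \<omega>)"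
    and zero: "\<And>n B. B \<in> sets (generated_sigma P \<gamma>) \<Longrightarrow> (LINT \<omega>:B|P. indicator (A n) \<omega> * L \<omega>) = 0"
  shows "cond_exp_zero P \<gamma> L"
proof -
  let ?G = "generated_sigma P \<gamma>"
  have ind [measurable]: "indicator (A n) \<in> borel_measurable ?G" "A n \<in> sets P" for n
    using A(1)[of n] subalgebra_generated_sigma by (auto simp: subalgebra_def)
  have "AE \<omega> in P. \<omega> \<in> A n \<longrightarrow> nn_cond_exp P ?G (\<lambda>\<omega>. ennreal \<bar>L \<omega>\<bar>) \<omega> < \<infinity>" for n
  proof -
    have [measurable]: "indicator (A n) \<in> borel_measurable ?G" using A(1)[of n] by simp
    have "(\<integral>\<^sup>+\<omega>. indicator (A n) \<omega> * nn_cond_exp P ?G (\<lambda>\<omega>. ennreal \<bar>L \<omega>\<bar>) \<omega> \<partial>P) =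
        (\<integral>\<^sup>+\<omega>. indicator (A n) \<omega> * ennreal \<bar>L \<omega>\<bar> \<partial>P)"
      by (rule jump_algebra.nn_cond_exp_intg) auto
    also have "\<dots> = (\<integral>\<^sup>+\<omega>. ennreal (norm (indicator (A n) \<omega> * L \<omega>)) \<partial>P)"
      by (intro nn_integral_cong) (simp add: indicator_def)
    also have "\<dots> < \<infinity>" using int[of n] by (simp add: integrable_iff_bounded)
    finally have "(\<integral>\<^sup>+\<omega>. indicator (A n) \<omega> * nn_cond_exp P ?G (\<lambda>\<omega>. ennreal \<bar>L \<omega>\<bar>) \<omega> \<partial>P) \<noteq> \<infinity>"
      by simp
    then have "AE \<omega> in P. indicator (A n) \<omega> * nn_cond_exp P ?G (\<lambda>\<omega>. ennreal \<bar>L \<omega>\<bar>) \<omega> \<noteq> \<infinity>"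
      by (intro nn_integral_PInf_AE) measurable
    then show ?thesis
      by eventually_elim (auto simp: less_top)
  qed
  then have "AE \<omega> in P. \<forall>n. \<omega> \<in> A n \<longrightarrow> nn_cond_exp P ?G (\<lambda>\<omega>. ennreal \<bar>L \<omega>\<bar>) \<omega> < \<infinity>"
    by (intro AE_all_countable[THEN iffD2] allI)
  with A(2) have fin: "AE \<omega> in P. nn_cond_exp P ?G (\<lambda>\<omega>. ennreal \<bar>L \<omega>\<bar>) \<omega> < \<infinity>"
    by eventually_elim blast
  have "AE \<omega> in P. \<omega> \<in> A n \<longrightarrow> real_cond_exp P ?G L \<omega> = 0" for n
  proof -
    have "AE \<omega> in P. real_cond_exp P ?G (\<lambda>\<omega>. indicator (A n) \<omega> * L \<omega>) \<omega> = 0"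
      by (rule jump_algebra.real_cond_exp_charact) (simp_all add: int zero)
    moreover have "AE \<omega> in P. real_cond_exp P ?G (\<lambda>\<omega>. indicator (A n) \<omega> * L \<omega>) \<omega> = indicator (A n) \<omega> * real_cond_exp P ?G L \<omega>"
      using A(1)[of n] by (intro jump_algebra.real_cond_exp_mult int) auto
    ultimately show ?thesis by eventually_elim auto
  qed
  then have "AE \<omega> in P. \<forall>n. \<omega> \<in> A n \<longrightarrow> real_cond_exp P ?G L \<omega> = 0"
    by (intro AE_all_countable[THEN iffD2] allI)
  with A(2) have "AE \<omega> in P. real_cond_exp P ?G L \<omega> = 0"
    by eventually_elim blast
  with fin show ?thesis by (simp add: cond_exp_zero_def)
qed

lemma jump_mean_cond_exp_zero:
  assumes L: "jump_integrable L" "cond_exp_zero P \<gamma> L" and t: "t \<in> \<T>"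
  shows "jump_mean L t = 0"
proof -
  note [measurable] = jump_integrableD(1)[OF L(1)]
  let ?I = "\<lambda>\<omega>. indicator {\<omega>. 0 < \<gamma> \<omega> \<and> \<gamma> \<omega> \<le> ennreal t} \<omega> :: real"
  have I [measurable]: "?I \<in> borel_measurable (generated_sigma P \<gamma>)" by measurable
  have "jump_mean L t = (LINT \<omega>|P. ?I \<omega> * L \<omega>)"
    by (simp add: jump_mean_def mult.commute)
  also have "\<dots> = (LINT \<omega>|P. ?I \<omega> * real_cond_exp P (generated_sigma P \<gamma>) L \<omega>)"
    using jump_integrable_Ioc[OF L(1) t, of 0]
    by (intro jump_algebra.real_cond_exp_intg(2)[symmetric]) (auto simp: mult.commute)
  also have "\<dots> = (LINT \<omega>|P. 0)"
    using L(2) by (intro integral_cong_AE) (auto simp: cond_exp_zero_def)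
  finally show ?thesis by simp
qed

lemma jump_integrable_add:
  assumes "jump_integrable J" "jump_integrable L"
  shows "jump_integrable (\<lambda>\<omega>. J \<omega> + L \<omega>)"
  using assms by (auto simp: jump_integrable_def distrib_right)

lemma jump_mean_add:
  assumes J: "jump_integrable J" and L: "jump_integrable L" and t: "t \<in> \<T>"
  shows "jump_mean (\<lambda>\<omega>. J \<omega> + L \<omega>) t = jump_mean J t + jump_mean L t"
  using jump_integrable_Ioc[OF J t, of 0] jump_integrable_Ioc[OF L t, of 0]
  by (simp add: jump_mean_def distrib_right)

lemma jump_integrable_iff_nn:
  assumes [measurable]: "L \<in> borel_measurable P"
  shows "jump_integrable L \<longleftrightarrow>
    (\<forall>t\<in>\<T>. (\<integral>\<^sup>+\<omega>. ennreal \<bar>L \<omega>\<bar> * indicator {\<omega>. \<gamma> \<omega> \<le> ennreal t} \<omega> \<partial>P) < \<infinity>)"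
  unfolding jump_integrable_def integrable_iff_bounded
  by (simp add: abs_mult ennreal_mult ennreal_indicator)

lemma mass_balance_add:
  assumes J: "mass_balance F J" and L: "jump_integrable L" "cond_exp_zero P \<gamma> L"
  shows "mass_balance F (\<lambda>\<omega>. J \<omega> + L \<omega>)"
  using jump_integrable_add[OF mass_balanceD(1)[OF J] L(1)] mass_balanceD(2)[OF J]
    jump_mean_add[OF mass_balanceD(1)[OF J] L(1)] jump_mean_cond_exp_zero[OF L]
  by (simp add: mass_balance_def)

text \<open>
  Conditioning \<open>J\<close> on \<open>\<gamma>\<close>. On \<open>{\<gamma> = \<infinity>}\<close>, which no \<open>t \<in> \<T>\<close> reaches, both \<open>J\<close> and the jump value of \<open>H\<close> vanish.
\<close>

lemma mass_balance_decompose: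
  assumes F: "mass_balance F J" and J_inf: "\<And>\<omega>. \<gamma> \<omega> = \<infinity> \<Longrightarrow> J \<omega> = 0"
  obtains H L where "H \<in> borel_measurable borel_\<T>" "mass_balance F (jump_value H)"
    "jump_integrable L" "cond_exp_zero P \<gamma> L" "(\<lambda>\<omega>. jump_value H \<omega> + L \<omega>) = J"
proof -
  let ?G = "generated_sigma P \<gamma>"
  note J = mass_balanceD(1)[OF F]
  note J_meas [measurable] = jump_integrableD(1)[OF J]
  obtain h :: "ennreal \<Rightarrow> real" where h [measurable]: "h \<in> borel_measurable borel"
    and h_eq: "\<And>\<omega>. \<omega> \<in> space P \<Longrightarrow> real_cond_exp P ?G J \<omega> = h (\<gamma> \<omega>)"
    using cond_exp_factor[of J] by blast
  define H where "H s = h (ennreal s)" for s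
  define L where "L \<omega> = J \<omega> - jump_value H \<omega>" for \<omega>
  have Hm: "H \<in> borel_measurable borel_\<T>"
    unfolding H_def by (intro measurable_restrict_space1) measurable
  note [measurable] = jump_value_measurable[OF Hm]
  have value_eq: "jump_value H \<omega> = real_cond_exp P ?G J \<omega>"
    if "\<omega> \<in> space P" "\<gamma> \<omega> \<le> ennreal t" "t \<in> \<T>" for \<omega> t
    using jump_value_eq[OF that(2,3), of H] h_eq[OF that(1)] that(2)
    by (cases "\<gamma> \<omega>") (auto simp: H_def top_unique)
  \<comment> \<open>weights \<open>I\<close> that are functions of \<open>\<gamma>\<close> and vanish for \<open>\<gamma> > t\<close> do not distinguish \<open>J\<close> from \<open>H(\<gamma>)\<close>\<close>
  have key: "integrable P (\<lambda>\<omega>. jump_value H \<omega> * I \<omega>)"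
    "(LINT \<omega>|P. jump_value H \<omega> * I \<omega>) = (LINT \<omega>|P. J \<omega> * I \<omega>)"
    if I: "I \<in> borel_measurable ?G" "\<And>\<omega>. \<omega> \<in> space P \<Longrightarrow> I \<omega> \<noteq> 0 \<Longrightarrow> \<gamma> \<omega> \<le> ennreal t"
      "integrable P (\<lambda>\<omega>. J \<omega> * I \<omega>)" and t: "t \<in> \<T>" for I t
  proof -
    have eq: "jump_value H \<omega> * I \<omega> = I \<omega> * real_cond_exp P ?G J \<omega>" if "\<omega> \<in> space P" for \<omega>
      using value_eq[OF that I(2)[OF that] t] by (cases "I \<omega> = 0") auto
    have int: "integrable P (\<lambda>\<omega>. I \<omega> * J \<omega>)" using I(3) by (simp add: mult.commute)
    show "integrable P (\<lambda>\<omega>. jump_value H \<omega> * I \<omega>)"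
      by (rule iffD2[OF Bochner_Integration.integrable_cong[OF refl eq]
          jump_algebra.real_cond_exp_intg(1)[OF int I(1) J_meas]])
    have "(LINT \<omega>|P. jump_value H \<omega> * I \<omega>) = (LINT \<omega>|P. I \<omega> * real_cond_exp P ?G J \<omega>)"
      by (intro Bochner_Integration.integral_cong refl eq)
    also have "\<dots> = (LINT \<omega>|P. I \<omega> * J \<omega>)"
      by (rule jump_algebra.real_cond_exp_intg(2)[OF int I(1) J_meas])
    finally show "(LINT \<omega>|P. jump_value H \<omega> * I \<omega>) = (LINT \<omega>|P. J \<omega> * I \<omega>)"
      by (simp add: mult.commute)
  qed
  have H: "jump_integrable (jump_value H)"
    unfolding jump_integrable_def
  proof (intro conjI ballI)
    fix t assume t: "t \<in> \<T>"
    show "integrable P (\<lambda>\<omega>. jump_value H \<omega> * indicator {\<omega>. \<gamma> \<omega> \<le> ennreal t} \<omega>)"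
      by (rule key(1)[OF _ _ jump_integrableD(2)[OF J t] t]) (measurable, simp add: indicator_def split: if_splits)
  qed measurable
  have mean: "jump_mean (jump_value H) t = jump_mean J t" if t: "t \<in> \<T>" for t
    unfolding jump_mean_def
    by (rule key(2)[OF _ _ _ t])
      (use jump_integrable_Ioc[OF J t, of 0] in \<open>measurable, auto simp: indicator_def split: if_splits\<close>)
  have FH: "mass_balance F (jump_value H)"
    using mass_balanceD(2)[OF F] mean H by (simp add: mass_balance_def)
  have L: "jump_integrable L"
    using J H unfolding L_def by (auto simp: jump_integrable_def left_diff_distrib)
  have L_inf: "L \<omega> = 0" if "\<gamma> \<omega> = \<infinity>" for \<omega>
    using J_inf[OF that] that by (simp add: L_def jump_value_def extend_zero_def)
  obtain \<tau> :: "nat \<Rightarrow> real" where \<tau>: "range \<tau> \<subseteq> \<T>" "\<And>t. t \<in> \<T> \<Longrightarrow> \<exists>n. t \<le> \<tau> n"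
    using times_cofinal by metis
  \<comment> \<open>\<open>{\<gamma> = \<infinity>}\<close> is included so that the \<open>A n\<close> exhaust almost every outcome; \<open>L\<close> vanishes there\<close>
  define A where "A n = {\<omega> \<in> space P. \<gamma> \<omega> \<le> ennreal (\<tau> n) \<or> \<gamma> \<omega> = \<infinity>}" for n
  have "cond_exp_zero P \<gamma> L"
  proof (rule cond_exp_zeroI[of L A])
    show "L \<in> borel_measurable P" by (rule jump_integrableD(1)[OF L])
    show A_G: "A n \<in> sets (generated_sigma P \<gamma>)" for n
    proof -
      have "{\<omega> \<in> space ?G. \<gamma> \<omega> \<le> ennreal (\<tau> n) \<or> \<gamma> \<omega> = \<infinity>} \<in> sets ?G" by measurable
      then show ?thesis by (simp add: A_def)
    qed
    show "AE \<omega> in P. \<exists>n. \<omega> \<in> A n"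
      using AE_jump_in_times AE_space
    proof eventually_elim
      case (elim \<omega>)
      show ?case
      proof (cases "\<gamma> \<omega> = \<infinity>")
        case False
        then obtain n where "enn2real (\<gamma> \<omega>) \<le> \<tau> n" using elim(1) \<tau>(2) by blast
        then have "ennreal (enn2real (\<gamma> \<omega>)) \<le> ennreal (\<tau> n)" by (rule ennreal_leI)
        then show ?thesis using False elim(2) by (auto simp: A_def less_top)
      qed (use elim(2) in \<open>simp add: A_def\<close>)
    qed
    have L_A: "indicator (A n) \<omega> * L \<omega> = L \<omega> * indicator {\<omega>. \<gamma> \<omega> \<le> ennreal (\<tau> n)} \<omega>" if "\<omega> \<in> space P" for n \<omega>
      using that L_inf[of \<omega>] by (auto simp: A_def indicator_def)
    have \<tau>T: "\<tau> n \<in> \<T>" for n using \<tau>(1) by auto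
    show int: "integrable P (\<lambda>\<omega>. indicator (A n) \<omega> * L \<omega>)" for n
      by (rule iffD2[OF Bochner_Integration.integrable_cong[OF refl L_A] jump_integrableD(2)[OF L \<tau>T]])
    show "(LINT \<omega>:B|P. indicator (A n) \<omega> * L \<omega>) = 0" if B: "B \<in> sets ?G" for n B
    proof -
      have BP: "B \<in> sets P" using B subalgebra_generated_sigma by (auto simp: subalgebra_def)
      let ?I = "\<lambda>\<omega>. indicator {\<omega>. \<gamma> \<omega> \<le> ennreal (\<tau> n)} \<omega> * indicator B \<omega> :: real"
      have I: "?I \<in> borel_measurable ?G" using B by measurable
      have J_int: "integrable P (\<lambda>\<omega>. J \<omega> * ?I \<omega>)"
        using integrable_mult_indicator[OF BP jump_integrableD(2)[OF J \<tau>T[of n]]] by (simp add: mult_ac)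
      note k = key[OF I _ J_int \<tau>T[of n]]
      have "(LINT \<omega>:B|P. indicator (A n) \<omega> * L \<omega>) = (LINT \<omega>|P. J \<omega> * ?I \<omega> - jump_value H \<omega> * ?I \<omega>)"
        unfolding set_lebesgue_integral_def
        by (intro Bochner_Integration.integral_cong refl) (simp add: L_A, simp add: L_def algebra_simps)
      also have "\<dots> = 0"
        using k J_int by (subst Bochner_Integration.integral_diff) (auto simp: indicator_def split: if_splits)
      finally show ?thesis .
    qed
  qed
  then show ?thesis
    by (intro that[OF Hm FH L]) (simp_all add: L_def fun_eq_iff)
qed

end

section \<open>The characterization of local martingales\<close>

theorem theorem2:
  fixes P :: "'a measure" and \<gamma> :: "'a \<Rightarrow> ennreal" and M :: "real \<Rightarrow> 'a \<Rightarrow> real"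
  assumes "prob_space P"
    and "\<gamma> \<in> borel_measurable P"
    and "measure P {\<omega> \<in> space P. \<gamma> \<omega> > 0} > 0"
    and "adapted_process (single_jump_filtration P \<gamma>) M"
    and "\<forall>\<omega>\<in>space P. right_continuous_path (\<lambda>t. M t \<omega>)"
  shows "local_martingale P (single_jump_filtration P \<gamma>) M \<longleftrightarrow>
    (\<exists>F H :: real \<Rightarrow> real. \<exists>L :: 'a \<Rightarrow> real.
       condition_M P \<gamma> F H \<and>
       (\<forall>t\<ge>0. jump_tG P \<gamma> \<le> ennreal t \<longrightarrow> continuous (at_right t) F) \<and>
       L \<in> borel_measurable P \<and>
       (\<forall>t\<in>jump_times P \<gamma>.
          (\<integral>\<^sup>+\<omega>. ennreal \<bar>L \<omega>\<bar> * indicator {\<omega>. \<gamma> \<omega> \<le> ennreal t} \<omega> \<partial>P) < \<infinity>) \<and>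
       cond_exp_zero P \<gamma> L \<and>
       indistinguishable P M (single_jump_process P \<gamma> F H L))"
proof -
  interpret single_jump P \<gamma>
    using assms by (simp add: single_jump_def single_jump_axioms_def)
  have process: "single_jump_process P \<gamma> F H L = jump_process F (\<lambda>\<omega>. jump_value H \<omega> + L \<omega>)" for F H L
    by (simp add: fun_eq_iff single_jump_process_def jump_process_def jump_value_def)
  show ?thesis (is "?lhs \<longleftrightarrow> ?rhs")
  proof
    assume ?lhs
    obtain F J where N: "indistinguishable P M (jump_process F J)" and J: "J \<in> borel_measurable P"
        and J_inf: "\<And>\<omega>. \<gamma> \<omega> = \<infinity> \<Longrightarrow> J \<omega> = 0" and F0: "\<And>t. t\<^sub>G \<le> ennreal t \<Longrightarrow> F t = 0"
      using local_martingale_jump_process[OF \<open>?lhs\<close> assms(5)] by metis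
    have F: "mass_balance F J" by (rule local_martingale_imp_mass_balance[OF \<open>?lhs\<close> N J])
    obtain H L where H: "H \<in> borel_measurable borel_\<T>" "mass_balance F (jump_value H)"
        and L: "jump_integrable L" "cond_exp_zero P \<gamma> L" and J_eq: "(\<lambda>\<omega>. jump_value H \<omega> + L \<omega>) = J"
      by (rule mass_balance_decompose[OF F J_inf])
    have "continuous (at_right t) F" if "t\<^sub>G \<le> ennreal t" for t
    proof -
      have "\<forall>\<^sub>F s in at_right t. F s = F t"
        using eventually_at_right_less[of t]
      proof eventually_elim
        case (elim s)
        then have "t\<^sub>G \<le> ennreal s" using that ennreal_leI[of t s] by (meson less_imp_le order_trans)
        then show ?case using F0 that by simp
      qed
      then show ?thesis unfolding continuous_within by (rule tendsto_eventually)
    qed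
    then show ?rhs
      using H L N jump_integrable_iff_nn[OF jump_integrableD(1)[OF L(1)]] jump_integrableD(1)[OF L(1)]
      by (intro exI[of _ F] exI[of _ H] exI[of _ L])
        (simp add: condition_M_iff_mass_balance process J_eq)
  next
    assume ?rhs
    then obtain F H L where FH: "condition_M P \<gamma> F H" and L: "L \<in> borel_measurable P"
        "\<forall>t\<in>\<T>. (\<integral>\<^sup>+\<omega>. ennreal \<bar>L \<omega>\<bar> * indicator {\<omega>. \<gamma> \<omega> \<le> ennreal t} \<omega> \<partial>P) < \<infinity>"
        "cond_exp_zero P \<gamma> L" and N: "indistinguishable P M (single_jump_process P \<gamma> F H L)"
      by blast
    have "mass_balance F (\<lambda>\<omega>. jump_value H \<omega> + L \<omega>)"
      using FH L jump_integrable_iff_nn[OF L(1)] by (intro mass_balance_add) (simp_all add: condition_M_iff_mass_balance)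
    then show ?lhs
      by (rule mass_balance_imp_local_martingale[OF _ assms(4) N[unfolded process] assms(5)])
  qed
qed

end
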